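(* Let $R$ be a commutative ${\mathbb Q}$-algebra (with $1$), let $M$ be an $R$-module, and let $a\in M^{{\mathbb N}}$ be an $R$-recurrence sequence. Then ${\mathcal Z}(a)=\{n\in{\mathbb N}\mid a(n)=0\}$ is the union of a finite set and finitely many infinite arithmetic progressions.
   Context: ${\mathbb N}=\{0,1,2,\dots\}$. For a commutative ring $R$ and an $R$-module $M$, a sequence $a\in M^{{\mathbb N}}$ is an $R$-recurrence sequence if there exist $d\ge 0$ and $\gamma_0,\dots,\gamma_{d-1}\in R$ with $a(n+d)=\gamma_{d-1}a(n+d-1)+\cdots+\gamma_0 a(n)$ for all $n\in{\mathbb N}$. An infinite arithmetic progression is a set $m+n{\mathbb N}$ with $m\in{\mathbb N}$ and $n$ a positive integer. *)

theory Defs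
  imports Complex_Main
begin

text \<open>A commutative ring R (type class comm_ring_1) is a Q-algebra when it is equipped
  with a unital ring homomorphism from the rationals into R (the structure map).\<close>
definition rat_algebra_map :: "(rat \<Rightarrow> 'r::comm_ring_1) \<Rightarrow> bool" where
  "rat_algebra_map phi \<longleftrightarrow> phi 1 = 1 \<and> (\<forall>x y. phi (x + y) = phi x + phi y)
      \<and> (\<forall>x y. phi (x * y) = phi x * phi y)"

definition recurrence_seq ::
  "('r::comm_ring_1 \<Rightarrow> 'm::ab_group_add \<Rightarrow> 'm) \<Rightarrow> (nat \<Rightarrow> 'm) \<Rightarrow> bool" where
  "recurrence_seq scale a \<longleftrightarrow> (\<exists>d::nat. \<exists>\<gamma>::nat \<Rightarrow> 'r.
      \<forall>n. a (n + d) = (\<Sum>i<d. scale (\<gamma> i) (a (n + i))))"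

definition arith_prog :: "nat \<Rightarrow> nat \<Rightarrow> nat set" where
  "arith_prog m n = {m + n * k | k. True}"

end

theory Submission
  imports Defs "Jordan_Normal_Form.Char_Poly" "HOL-Library.Function_Algebras" "HOL-Number_Theory.Cong"
begin

text \<open>
  Let the polynomial ring \<open>\<int>[x\<^sub>0, \<dots>, x\<^sub>d\<^sub>-\<^sub>1]\<close> act on \<open>M\<close> through the coefficients of the recurrence; since
  \<open>R\<close> contains the rationals, \<open>M\<close> is torsion-free over \<open>\<int>\<close>. Call a set \<open>Y\<close> of variables independent
  for \<open>a\<close> if no nonzero polynomial in \<open>Y\<close> annihilates all values of \<open>a\<close>; the proof is by induction on the
  number of independent sets. If there is none, a nonzero integer kills \<open>a\<close>, so \<open>a = 0\<close>. Otherwise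
  take a maximal independent \<open>Y\<close>: the other variables are algebraic over \<open>\<int>[Y]\<close>, so for some nonzero
  \<open>l\<close> in \<open>\<int>[Y]\<close> the sequence \<open>l\<^sup>n a(n)\<close> satisfies a monic recurrence over \<open>\<int>[Y]\<close>.

  Modulo torsion, a rank one quotient turns this into a recurrence of elements of \<open>\<int>[Y]\<close>. Choose an
  integer point \<open>b\<close> and a prime \<open>p\<close> such that the last coefficient is nonzero modulo \<open>p\<close> at \<open>b\<close>. Evaluating
  at any point congruent to \<open>b\<close> modulo \<open>p\<close> gives an integer recurrence, and all of these are periodic
  modulo \<open>p\<^sup>2\<close> with one common period \<open>k\<close>; by Hansel's argument, along each residue class modulo \<open>k\<close> each of
  them either vanishes or has finitely many zeros. Such points being Zariski dense, a class
  modulo \<open>k\<close> on which \<open>a\<close> has infinitely many zeros consists of \<open>\<int>[Y]\<close>-torsion values. The subsequence of \<open>a\<close>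
  along such a class is again a linear recurrence, for which \<open>Y\<close> is no longer independent.
\<close>

(* HOL-Algebra, loaded with Jordan_Normal_Form, has other constants of these names. *)
hide_const (open) Module.module Module.smult

section \<open>Zeros of integer recurrences\<close>

text \<open>The ideal generated by \<open>p ^ s\<close> in the localisation of the integers at
  \<open>p\<close>, as a set of rationals. Exhibiting the denominator avoids a valuation, and 0 is
  no special case.\<close>

definition padic_ideal :: "int \<Rightarrow> nat \<Rightarrow> rat set" where
  "padic_ideal p s = {x. \<exists>u v. \<not> p dvd v \<and> x * of_int v = of_int (p ^ s * u)}"

lemma padic_idealI: "\<not> p dvd v \<Longrightarrow> x * of_int v = of_int (p ^ s * u) \<Longrightarrow> x \<in> padic_ideal p s"
  unfolding padic_ideal_def by blast

lemma padic_ideal_add: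
  assumes "prime p" "x \<in> padic_ideal p s" "y \<in> padic_ideal p s"
  shows "x + y \<in> padic_ideal p s"
proof -
  obtain u v where 1: "\<not> p dvd v" "x * of_int v = of_int (p ^ s * u)"
    using assms(2) unfolding padic_ideal_def by blast
  obtain u' v' where 2: "\<not> p dvd v'" "y * of_int v' = of_int (p ^ s * u')"
    using assms(3) unfolding padic_ideal_def by blast
  have "(x + y) * of_int (v * v') = (x * of_int v) * of_int v' + (y * of_int v') * of_int v"
    by (simp add: algebra_simps)
  also have "\<dots> = of_int (p ^ s * (u * v' + u' * v))"
    by (simp only: 1 2) (simp add: algebra_simps)
  finally have "(x + y) * of_int (v * v') = of_int (p ^ s * (u * v' + u' * v))" .
  moreover have "\<not> p dvd v * v'" using 1 2 assms(1) by (simp add: prime_dvd_mult_iff)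
  ultimately show ?thesis by (rule padic_idealI[rotated])
qed

lemma padic_ideal_Ints_mult:
  assumes "c \<in> \<int>" "x \<in> padic_ideal p s"
  shows "c * x \<in> padic_ideal p s"
proof -
  obtain u v where 1: "\<not> p dvd v" "x * of_int v = of_int (p ^ s * u)"
    using assms(2) unfolding padic_ideal_def by blast
  obtain d where d: "c = of_int d" using assms(1) by (rule Ints_cases)
  have "c * x * of_int v = c * (x * of_int v)" by simp
  also have "\<dots> = of_int (p ^ s * (d * u))" by (simp only: 1 d) simp
  finally show ?thesis using 1 by (intro padic_idealI)
qed

lemma padic_ideal_0: "prime p \<Longrightarrow> 0 \<in> padic_ideal p s"
  by (rule padic_idealI[of _ 1 _ _ 0]) (auto simp: not_prime_unit)

lemma padic_ideal_sum:
  "prime p \<Longrightarrow> (\<And>i. i \<in> A \<Longrightarrow> f i \<in> padic_ideal p s) \<Longrightarrow> sum f A \<in> padic_ideal p s"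
  by (induction A rule: infinite_finite_induct) (auto simp: padic_ideal_0 padic_ideal_add)

lemma padic_ideal_antimono:
  assumes "s \<le> t" "x \<in> padic_ideal p t"
  shows "x \<in> padic_ideal p s"
proof -
  obtain u v where 1: "\<not> p dvd v" "x * of_int v = of_int (p ^ t * u)"
    using assms(2) unfolding padic_ideal_def by blast
  have "p ^ t * u = p ^ s * (p ^ (t - s) * u)"
    using assms(1) by (simp flip: power_add mult.assoc)
  then show ?thesis using 1 by (metis padic_idealI)
qed

text \<open>The denominators are coprime to \<open>p\<close>, so clearing them shows that every
  power of \<open>p\<close> divides the integer \<open>x\<close>; a nonzero integer has only
  finitely many such divisors.\<close>

lemma padic_ideal_separated:
  assumes "prime p" "\<And>s. of_int x \<in> padic_ideal p s"
  shows "x = 0"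
proof (rule ccontr)
  assume x: "x \<noteq> 0"
  have "p ^ s dvd x" for s
  proof -
    obtain u v where 1: "\<not> p dvd v" "of_int x * of_int v = (of_int (p ^ s * u) :: rat)"
      using assms(2)[of s] unfolding padic_ideal_def by blast
    then have "x * v = p ^ s * u" by (metis of_int_eq_iff of_int_mult)
    moreover have "coprime (p ^ s) v"
      using 1(1) assms(1) by (simp add: prime_imp_coprime)
    ultimately show ?thesis by (metis coprime_dvd_mult_left_iff dvd_triv_left)
  qed
  then show False
    using x assms(1) finite_divisor_powers[of x p] by (auto simp: not_prime_unit)
qed

text \<open>One round of Legendre's formula: the multiples of \<open>p\<close> up to
  \<open>j\<close> are \<open>p\<close> times 1, ..., \<open>j div p\<close>, and all other factors
  of \<open>fact j\<close> are prime to \<open>p\<close>.\<close>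

lemma prime_power_part_fact:
  fixes p :: nat
  assumes "prime p"
  shows "\<exists>v. \<not> p dvd v \<and> fact j = p ^ (j div p) * fact (j div p) * v"
proof (induction j)
  case 0
  then show ?case using assms by (intro exI[of _ 1]) (auto simp: prime_gt_0_nat not_prime_unit)
next
  case (Suc j)
  then obtain v where v: "\<not> p dvd v" "fact j = p ^ (j div p) * fact (j div p) * v" by blast
  show ?case
  proof (cases "p dvd Suc j")
    case True
    then obtain c where c: "Suc j = p * c" by blast
    then have "c > 0" by (cases c) auto
    have "Suc j div p = Suc (j div p)" using True by (simp add: div_Suc dvd_eq_mod_eq_0)
    moreover have "Suc j div p = c" unfolding c using assms by (simp add: prime_gt_0_nat)
    ultimately have c': "Suc j = p * Suc (j div p)" "Suc j div p = Suc (j div p)" using c by auto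
    have "fact (Suc j) = Suc j * fact j" by simp
    also have "\<dots> = p * Suc (j div p) * (p ^ (j div p) * fact (j div p) * v)"
      by (simp only: v(2) c'(1))
    also have "\<dots> = p ^ (Suc j div p) * fact (Suc j div p) * v"
      unfolding c'(2) by (simp add: algebra_simps)
    finally have "fact (Suc j) = p ^ (Suc j div p) * fact (Suc j div p) * v" .
    then show ?thesis using v by blast
  next
    case False
    then have "fact (Suc j) = p ^ (Suc j div p) * fact (Suc j div p) * (Suc j * v)"
      unfolding fact_Suc v(2) by (simp add: div_Suc dvd_eq_mod_eq_0 algebra_simps)
    moreover have "\<not> p dvd Suc j * v" using False v assms by (simp only: prime_dvd_mult_iff) simp
    ultimately show ?thesis by blast
  qed
qed

text \<open>Iterating the previous lemma bounds the exponent of \<open>p\<close> in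
  \<open>fact j\<close>: it is \<open>j div p\<close> plus an exponent of at most
  \<open>j div p\<close>, and \<open>2 * (j div p) \<le> j\<close>.\<close>

lemma prime_power_part_fact_le:
  fixes p :: nat
  assumes "prime p"
  shows "\<exists>e v. \<not> p dvd v \<and> e \<le> j \<and> fact j = p ^ e * v"
proof (induction j rule: less_induct)
  case (less j)
  show ?case
  proof (cases "j = 0")
    case True
    then show ?thesis using assms by (intro exI[of _ 0] exI[of _ 1]) (auto simp: not_prime_unit)
  next
    case False
    have p2: "p \<ge> 2" using assms by (rule prime_ge_2_nat)
    with False have "j div p < j" by simp
    then obtain e v where 1: "\<not> p dvd v" "e \<le> j div p" "fact (j div p) = p ^ e * v"
      using less by blast
    obtain w where w: "\<not> p dvd w" "fact j = p ^ (j div p) * fact (j div p) * w"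
      using prime_power_part_fact[OF assms] by blast
    have "fact j = p ^ (j div p + e) * (v * w)" using w 1 by (simp add: power_add)
    moreover have "\<not> p dvd v * w" using w 1 assms by (simp add: prime_dvd_mult_iff)
    moreover have "2 * (j div p) \<le> p * (j div p)" using p2 by (intro mult_right_mono) auto
    then have "2 * (j div p) \<le> j" by (meson le_trans times_div_less_eq_dividend)
    then have "j div p + e \<le> j" using 1(2) by simp
    ultimately show ?thesis by blast
  qed
qed

text \<open>Since \<open>fact j\<close> contains \<open>p\<close> at most \<open>j\<close> times, at
  least \<open>j\<close> of the \<open>2 * j\<close> factors survive. This holds for every prime,
  including 2, and is the reason for working modulo \<open>p\<close> squared.\<close>

lemma padic_ideal_power_over_fact:
  assumes "prime p"
  shows "of_int (p ^ (2 * j)) / fact j \<in> padic_ideal p j"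
proof -
  define q where "q = nat p"
  have q: "prime q" "int q = p" using assms by (auto simp: q_def prime_ge_0_int)
  obtain e v where e: "\<not> q dvd v" "e \<le> j" "fact j = q ^ e * v"
    using prime_power_part_fact_le[OF q(1)] by blast
  have "(fact j :: rat) = of_nat (fact j)" by simp
  also have "\<dots> = of_int p ^ e * of_nat v"
    unfolding e(3) q(2)[symmetric] by (simp only: of_nat_mult of_nat_power of_int_of_nat_eq)
  finally have f: "(fact j :: rat) = of_int p ^ e * of_nat v" .
  have v0: "v \<noteq> 0" using e(1) by (cases v) auto
  have p0: "p \<noteq> 0" using assms by auto
  have "2 * j = e + (j + (j - e))" using e(2) by simp
  then have "p ^ (2 * j) = p ^ e * (p ^ j * p ^ (j - e))" by (metis power_add)
  then have "of_int (p ^ (2 * j)) / fact j * (of_int (int v) :: rat) = of_int (p ^ j * p ^ (j - e))"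
    unfolding f using v0 p0 by (simp add: divide_simps)
  moreover have "\<not> p dvd int v" using e(1) q(2) by auto
  ultimately show ?thesis by (intro padic_idealI)
qed

text \<open>In synthetic division by a linear factor, coefficient \<open>i\<close> of the quotient
  is built from the coefficients at \<open>Suc i\<close> of the dividend and of the quotient. The
  index shift is what gains one factor \<open>p\<close> per root.\<close>

lemma padic_ideal_root_division:
  fixes R :: "rat poly"
  assumes p: "prime p" and "finite X"
    and "\<And>i. coeff R i \<in> padic_ideal p (i + s)"
    and "\<And>x. x \<in> X \<Longrightarrow> poly R (of_int x) = 0"
  shows "\<exists>Q. R = (\<Prod>x\<in>X. [:- of_int x, 1:]) * Q \<and> (\<forall>i. coeff Q i \<in> padic_ideal p (i + s + card X))"
  using assms(2-)
proof (induction X arbitrary: R s rule: finite_induct)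
  case empty
  then show ?case by (intro exI[of _ R]) auto
next
  case (insert x X)
  have "poly R (of_int x) = 0" using insert.prems by simp
  then obtain Q where Q: "R = [:- of_int x, 1:] * Q" by (auto simp: poly_eq_0_iff_dvd)
  have step: "coeff Q i = coeff R (Suc i) + of_int x * coeff Q (Suc i)" for i
    by (simp add: Q)
  \<comment> \<open>Descending induction on the index: beyond the degree all coefficients vanish,
    and each increment of \<open>k\<close> reaches one index lower.\<close>
  have "\<forall>i. i + k > degree Q \<longrightarrow> coeff Q i \<in> padic_ideal p (i + Suc s)" for k
  proof (induction k)
    case 0
    then show ?case by (auto simp: coeff_eq_0 padic_ideal_0[OF p])
  next
    case (Suc k)
    show ?case
    proof (intro allI impI)
      fix i assume i: "i + Suc k > degree Q"
      have "Suc i + k > degree Q" using i by simp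
      then have "coeff Q (Suc i) \<in> padic_ideal p (Suc i + Suc s)" using Suc by blast
      then have "of_int x * coeff Q (Suc i) \<in> padic_ideal p (i + Suc s)"
        by (intro padic_ideal_Ints_mult) (auto intro: padic_ideal_antimono[rotated])
      moreover have "coeff R (Suc i) \<in> padic_ideal p (i + Suc s)"
        using insert.prems(1)[of "Suc i"] by simp
      ultimately show "coeff Q i \<in> padic_ideal p (i + Suc s)"
        by (subst step) (intro padic_ideal_add p)
    qed
  qed
  from this[of "Suc (degree Q)"] have "coeff Q i \<in> padic_ideal p (i + Suc s)" for i
    by (meson less_add_Suc1 less_Suc_eq_le le_add2 lessI less_le_trans trans_le_add2)
  moreover have "poly Q (of_int y) = 0" if "y \<in> X" for y
  proof -
    have "poly R (of_int y) = 0" "y \<noteq> x" using insert that by auto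
    then show ?thesis by (simp add: Q)
  qed
  ultimately obtain Q' where "Q = (\<Prod>x\<in>X. [:- of_int x, 1:]) * Q'"
      "\<forall>i. coeff Q' i \<in> padic_ideal p (i + Suc s + card X)"
    using insert.IH by blast
  moreover have "R = (\<Prod>x\<in>insert x X. [:- of_int x, 1:]) * Q'"
    unfolding prod.insert[OF insert.hyps] mult.assoc using Q calculation(1) by simp
  ultimately show ?case using insert.hyps by (intro exI[of _ Q']) auto
qed

lemma coeff_prod_linear_Ints:
  "coeff (\<Prod>i<j. [:- of_nat i, 1:] :: rat poly) l \<in> \<int>"
proof (induction j arbitrary: l)
  case 0
  then show ?case by (auto simp: one_pCons coeff_pCons split: nat.splits)
next
  case (Suc j)
  then show ?case by (cases l) (auto simp: coeff_pCons mult.commute[of _ "[:_, _:]"] split: nat.splits)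
qed

text \<open>A Mahler series with coefficients divisible by \<open>p\<^sup>2\<^sup>j\<close> is locally a polynomial whose \<open>i\<close>-th
  coefficient lies in \<open>p\<^sup>i\<int>\<close> localised at \<open>p\<close>; every integer root divided out gains a factor \<open>p\<close>.\<close>
lemma binomial_series_zero:
  fixes u b :: "nat \<Rightarrow> int"
  assumes p: "prime p"
    and u: "\<And>n. u n = (\<Sum>j\<le>n. of_nat (n choose j) * (p ^ (2 * j) * b j))"
    and inf: "infinite {n. u n = 0}"
  shows "u n = 0"
proof (rule padic_ideal_separated[OF p])
  fix t
  obtain T where T: "finite T" "card T = t" "T \<subseteq> {n. u n = 0}"
    using infinite_arbitrarily_large[OF inf] by metis
  \<comment> \<open>Truncating the series at \<open>m\<close> is exact at \<open>n\<close> and at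
    the \<open>t\<close> chosen zeros, because \<open>x choose j\<close> vanishes for
    \<open>j > x\<close>.\<close>
  define m where "m = Max (insert n T)"
  have le_m: "x \<le> m" if "x \<in> insert n T" for x
    using T(1) that unfolding m_def by (intro Max_ge) auto
  \<comment> \<open>The Newton interpolation polynomial of \<open>u\<close> at 0, ...,
    \<open>m\<close>, with each binomial coefficient written as a falling factorial over
    \<open>fact j\<close>.\<close>
  define R :: "rat poly" where
    "R = (\<Sum>j\<le>m. smult (of_int (b j) * (of_int (p ^ (2 * j)) / fact j)) (\<Prod>i<j. [:- of_nat i, 1:]))"
  have R: "poly R (of_int (int x)) = of_int (u x)" if "x \<le> m" for x
  proof -
    have "poly R (of_int (int x)) =
        (\<Sum>j\<le>m. of_int (b j) * of_int (p ^ (2 * j)) * (of_nat x gchoose j))"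
      unfolding R_def poly_sum by (simp add: gbinomial_prod_rev poly_prod atLeast0LessThan)
    also have "\<dots> = (\<Sum>j\<le>m. of_nat (x choose j) * (of_int (p ^ (2 * j) * b j)))"
      by (intro sum.cong refl) (simp add: binomial_gbinomial)
    also have "\<dots> = (\<Sum>j\<le>x. of_nat (x choose j) * (of_int (p ^ (2 * j) * b j)))"
      using that by (intro sum.mono_neutral_right) (auto simp: binomial_eq_0)
    also have "\<dots> = of_int (u x)" unfolding u by simp
    finally show ?thesis .
  qed
  have coeffs: "coeff R i \<in> padic_ideal p (i + 0)" for i
    unfolding R_def coeff_sum coeff_smult
  proof (rule padic_ideal_sum[OF p])
    fix j
    let ?P = "\<Prod>i<j. [:- of_nat i, 1:] :: rat poly"
    show "of_int (b j) * (of_int (p ^ (2 * j)) / fact j) * coeff ?P i \<in> padic_ideal p (i + 0)"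
    proof (cases "i \<le> j")
      case True
      have "of_int (b j) * coeff ?P i * (of_int (p ^ (2 * j)) / fact j) \<in> padic_ideal p (i + 0)"
        using True by (intro padic_ideal_Ints_mult padic_ideal_antimono[OF _ padic_ideal_power_over_fact[OF p]]
            Ints_mult coeff_prod_linear_Ints) auto
      then show ?thesis by (simp add: mult_ac)
    next
      case False
      have "degree ?P \<le> (\<Sum>i<j. degree [:- of_nat i, 1 :: rat:])"
        using degree_prod_sum_le[of "{..<j}" "\<lambda>i. [:- of_nat i, 1::rat:]"] by (simp add: o_def)
      also have "\<dots> = j" by simp
      finally have "coeff ?P i = 0" using False by (simp add: coeff_eq_0)
      then show ?thesis by (simp add: padic_ideal_0[OF p])
    qed
  qed
  have "poly R (of_int x) = 0" if "x \<in> int ` T" for x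
    using that R le_m T(3) by fastforce
  from padic_ideal_root_division[OF p finite_imageI[OF T(1)] coeffs this]
  obtain Q where Q: "R = (\<Prod>x\<in>int ` T. [:- of_int x, 1:]) * Q"
    "\<And>i. coeff Q i \<in> padic_ideal p (i + 0 + card (int ` T))" by blast
  have "card (int ` T) = t" using T by (simp add: card_image)
  then have "coeff Q i \<in> padic_ideal p t" for i
    using Q(2)[of i] by (auto intro: padic_ideal_antimono[rotated])
  then have "poly Q (of_nat n) \<in> padic_ideal p t"
    unfolding poly_altdef by (intro padic_ideal_sum[OF p]) (subst mult.commute, auto intro!: padic_ideal_Ints_mult)
  moreover have "of_int (u n) = (\<Prod>x\<in>int ` T. of_nat n - of_int x) * poly Q (of_nat n)"
    using R[of n] le_m[of n] Q(1) by (simp add: poly_prod)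
  moreover have "(\<Prod>x\<in>int ` T. of_nat n - of_int x :: rat) \<in> \<int>"
    by (intro Ints_prod) auto
  ultimately show "of_int (u n) \<in> padic_ideal p t"
    by (simp add: padic_ideal_Ints_mult)
qed

text \<open>By pigeonhole two windows of length \<open>D\<close> agree modulo \<open>N\<close>. As
  \<open>g 0\<close> is invertible modulo \<open>N\<close>, the recurrence also runs backwards, so
  the period starts at 0. The factorial is a multiple of every possible period, hence depends only
  on \<open>N\<close> and \<open>D\<close> and not on the sequence.\<close>

lemma recurrence_periodic_mod:
  fixes \<beta> g :: "nat \<Rightarrow> int" and N D :: nat
  assumes rec: "\<And>n. \<beta> (n + D) = (\<Sum>i<D. g i * \<beta> (n + i))"
    and N: "N > 0" and cop: "coprime (g 0) (int N)"
  shows "[\<beta> (n + fact (N ^ D)) = \<beta> n] (mod int N)"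
proof (cases "D = 0")
  case True
  then show ?thesis using rec by auto
next
  case False
  define E where "E n m \<longleftrightarrow> (\<forall>i<D. [\<beta> (n + i) = \<beta> (m + i)] (mod int N))" for n m
  have fwd: "E (Suc n) (Suc m)" if "E n m" for n m
    unfolding E_def
  proof (intro allI impI)
    fix i assume "i < D"
    show "[\<beta> (Suc n + i) = \<beta> (Suc m + i)] (mod int N)"
    proof (cases "Suc i < D")
      case True
      then show ?thesis using that unfolding E_def by fastforce
    next
      case False
      with \<open>i < D\<close> have "Suc i = D" by simp
      then have eq: "Suc n + i = n + D" "Suc m + i = m + D" by auto
      show ?thesis unfolding eq rec
        using that unfolding E_def by (intro cong_sum cong_scalar_left) auto
    qed
  qed
  have bwd: "E n m" if "E (Suc n) (Suc m)" for n m
  proof -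
    have *: "[\<beta> (n + i) = \<beta> (m + i)] (mod int N)" if "0 < i" "i \<le> D" for i
      using \<open>E (Suc n) (Suc m)\<close> that unfolding E_def by (cases i) auto
    have split: "\<beta> (x + D) - (\<Sum>i=1..<D. g i * \<beta> (x + i)) = g 0 * \<beta> x" for x
      using False by (simp add: rec lessThan_atLeast0 sum.atLeast_Suc_lessThan)
    have "[\<beta> (n + D) - (\<Sum>i=1..<D. g i * \<beta> (n + i)) = \<beta> (m + D) - (\<Sum>i=1..<D. g i * \<beta> (m + i))] (mod int N)"
      by (intro cong_diff cong_sum cong_scalar_left *) (use False in auto)
    then have "[g 0 * \<beta> n = g 0 * \<beta> m] (mod int N)" unfolding split .
    then have "[\<beta> n = \<beta> m] (mod int N)" using cop by (simp add: cong_mult_lcancel)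
    then show ?thesis unfolding E_def using * by (metis add_0_right less_imp_le not_gr0)
  qed
  define st where "st n = map (\<lambda>i. \<beta> (n + i) mod int N) [0..<D]" for n
  define S where "S = {xs. set xs \<subseteq> {0..<int N} \<and> length xs = D}"
  have S: "finite S" "card S = N ^ D"
    unfolding S_def using card_lists_length_eq[of "{0..<int N}" D] finite_lists_length_eq[of "{0..<int N}" D]
    by auto
  have "st ` {..N ^ D} \<subseteq> S" using N by (auto simp: st_def S_def)
  then have "card (st ` {..N ^ D}) < card {..N ^ D}"
    using S card_mono[OF S(1)] by (metis card_atMost le_imp_less_Suc)
  then have "\<not> inj_on st {..N ^ D}" by (metis card_image less_irrefl)
  then obtain i j where ij: "i < j" "j \<le> N ^ D" "st i = st j"
    unfolding inj_on_def by (metis atMost_iff linorder_neqE_nat)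
  have "E i j" using ij(3) unfolding E_def st_def cong_def by (auto simp: map_eq_conv)
  then have "E 0 (j - i)" using ij(1)
  proof (induction i arbitrary: j)
    case (Suc i)
    then show ?case using bwd[of i "j - 1"] by (metis Suc_diff_1 Suc_less_eq bot_nat_0.not_eq_extremum diff_Suc_Suc not_less0)
  qed simp
  then have E: "E n (n + (j - i))" for n
    by (induction n) (auto dest: fwd)
  have "(j - i) dvd fact (N ^ D)" using ij by (intro dvd_fact) auto
  then obtain q where q: "fact (N ^ D) = (j - i) * q" by blast
  have "[\<beta> (n + (j - i) * q) = \<beta> n] (mod int N)" for q
  proof (induction q)
    case (Suc q)
    have "[\<beta> (n + (j - i) * q) = \<beta> (n + (j - i) * q + (j - i))] (mod int N)"
      using E[of "n + (j - i) * q"] False unfolding E_def by force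
    then show ?case using Suc by (metis add.assoc add.commute cong_sym cong_trans mult_Suc_right)
  qed simp
  then show ?thesis using q by simp
qed

text \<open>Pascal's rule, in the form needed to expand powers of an operator 1 + d.\<close>

lemma sum_binomial_Suc:
  fixes f :: "nat \<Rightarrow> 'a::comm_ring_1"
  shows "(\<Sum>j\<le>Suc n. of_nat (Suc n choose j) * f j)
    = (\<Sum>j\<le>n. of_nat (n choose j) * f j) + (\<Sum>j\<le>n. of_nat (n choose j) * f (Suc j))"
proof -
  have "(\<Sum>j\<le>n. of_nat (n choose j) * f j) = (\<Sum>j\<le>Suc n. of_nat (n choose j) * f j)"
    by (simp add: binomial_eq_0)
  also have "\<dots> = f 0 + (\<Sum>j\<le>n. of_nat (n choose Suc j) * f (Suc j))"
    by (subst sum.atMost_Suc_shift) simp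
  finally show ?thesis
    by (subst sum.atMost_Suc_shift) (simp add: algebra_simps sum.distrib)
qed

text \<open>Hansel's argument. Shifting by the period \<open>k\<close> modulo \<open>p\<close>
  squared acts as 1 plus \<open>p\<close> squared times \<open>d\<close>, where \<open>d\<close>
  again yields solutions of the same recurrence. Expanding the \<open>n\<close>-th power of this
  operator at \<open>r\<close> gives a Mahler series of the kind treated in
  \<open>binomial_series_zero\<close>.\<close>

lemma integer_recurrence_zeros:
  fixes p :: nat and \<beta> g :: "nat \<Rightarrow> int"
  assumes p: "prime p" and g0: "\<not> int p dvd g 0"
    and rec: "\<And>n. \<beta> (n + D) = (\<Sum>i<D. g i * \<beta> (n + i))"
    and inf: "infinite {n. \<beta> (r + fact ((p\<^sup>2) ^ D) * n) = 0}"
  shows "\<beta> (r + fact ((p\<^sup>2) ^ D) * n) = 0"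
proof -
  define k :: nat where "k = fact ((p\<^sup>2) ^ D)"
  define R where "R \<beta> \<longleftrightarrow> (\<forall>n. \<beta> (n + D) = (\<Sum>i<D. g i * \<beta> (n + i)))" for \<beta>
  have cop: "coprime (g 0) (int (p\<^sup>2))"
    using p g0 by (simp add: coprime_commute prime_imp_coprime)
  define d where "d \<beta> n = (\<beta> (n + k) - \<beta> n) div int (p\<^sup>2)" for \<beta> :: "nat \<Rightarrow> int" and n
  have p0: "int (p\<^sup>2) \<noteq> 0" using p by auto
  have d: "\<beta> (n + k) = \<beta> n + int (p\<^sup>2) * d \<beta> n" if "R \<beta>" for \<beta> n
  proof -
    have "[\<beta> (n + k) = \<beta> n] (mod int (p\<^sup>2))"
      unfolding k_def using that p cop unfolding R_def
      by (intro recurrence_periodic_mod[where g = g]) (auto simp: prime_gt_0_nat)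
    then have "int (p\<^sup>2) dvd \<beta> (n + k) - \<beta> n" by (simp add: cong_iff_dvd_diff)
    then show ?thesis unfolding d_def by simp
  qed
  have dR: "R (d \<beta>)" if "R \<beta>" for \<beta>
    unfolding R_def
  proof
    fix n
    have "int (p\<^sup>2) * d \<beta> (n + D) = \<beta> (n + k + D) - \<beta> (n + D)"
      using d[OF that, of "n + D"] by (simp add: add_ac)
    also have "\<dots> = (\<Sum>i<D. g i * \<beta> (n + k + i)) - (\<Sum>i<D. g i * \<beta> (n + i))"
      using that unfolding R_def by metis
    also have "\<dots> = (\<Sum>i<D. g i * (\<beta> (n + i + k) - \<beta> (n + i)))"
      by (simp add: right_diff_distrib sum_subtractf add_ac)
    also have "\<dots> = int (p\<^sup>2) * (\<Sum>i<D. g i * d \<beta> (n + i))"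
      by (simp add: d[OF that] sum_distrib_left mult_ac)
    finally show "d \<beta> (n + D) = (\<Sum>i<D. g i * d \<beta> (n + i))" using p0 by simp
  qed
  have expand: "\<beta> (r + k * n) = (\<Sum>j\<le>n. of_nat (n choose j) * (int (p\<^sup>2) ^ j * (d ^^ j) \<beta> r))"
    if "R \<beta>" for \<beta> n
    using that
  proof (induction n arbitrary: \<beta>)
    case (Suc n)
    have "\<beta> (r + k * Suc n) = \<beta> (r + k * n) + int (p\<^sup>2) * d \<beta> (r + k * n)"
      using d[OF Suc.prems, of "r + k * n"] by (simp add: add_ac)
    also have "\<dots> = (\<Sum>j\<le>Suc n. of_nat (Suc n choose j) * (int (p\<^sup>2) ^ j * (d ^^ j) \<beta> r))"
      unfolding sum_binomial_Suc Suc.IH[OF Suc.prems] Suc.IH[OF dR[OF Suc.prems]]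
      by (simp add: sum_distrib_left funpow_swap1 mult_ac)
    finally show ?case .
  qed simp
  have R: "R \<beta>" using rec unfolding R_def by blast
  have "\<beta> (r + k * n) = (\<Sum>j\<le>n. of_nat (n choose j) * (int p ^ (2 * j) * (d ^^ j) \<beta> r))" for n
    by (simp add: expand[OF R] power_mult)
  moreover have "prime (int p)" using p by simp
  ultimately show ?thesis
    using inf binomial_series_zero[of "int p" "\<lambda>n. \<beta> (r + k * n)" "\<lambda>j. (d ^^ j) \<beta> r" n]
    unfolding k_def by blast
qed

section \<open>Integer polynomials in countably many variables\<close>

inductive_set polyfun :: "nat set \<Rightarrow> ((nat \<Rightarrow> int) \<Rightarrow> int) set" for Y where
  const: "(\<lambda>_. c) \<in> polyfun Y"
| var: "i \<in> Y \<Longrightarrow> (\<lambda>z. z i) \<in> polyfun Y"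
| add: "f \<in> polyfun Y \<Longrightarrow> g \<in> polyfun Y \<Longrightarrow> (\<lambda>z. f z + g z) \<in> polyfun Y"
| mult: "f \<in> polyfun Y \<Longrightarrow> g \<in> polyfun Y \<Longrightarrow> (\<lambda>z. f z * g z) \<in> polyfun Y"

lemma polyfun_mono: "f \<in> polyfun Y \<Longrightarrow> Y \<subseteq> Z \<Longrightarrow> f \<in> polyfun Z"
  by (induction rule: polyfun.induct) (auto intro: polyfun.intros)

lemma polyfun_finite: "f \<in> polyfun Y \<Longrightarrow> \<exists>F. finite F \<and> F \<subseteq> Y \<and> f \<in> polyfun F"
proof (induction rule: polyfun.induct)
  case (const c)
  then show ?case by (auto intro!: exI[of _ "{}"] polyfun.const)
next
  case (var i)
  then show ?case by (auto intro!: exI[of _ "{i}"] polyfun.var)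
next
  case (add f g)
  then obtain F G where "finite F" "F \<subseteq> Y" "f \<in> polyfun F" "finite G" "G \<subseteq> Y" "g \<in> polyfun G" by blast
  then show ?case by (intro exI[of _ "F \<union> G"]) (auto intro: polyfun.add polyfun_mono)
next
  case (mult f g)
  then obtain F G where "finite F" "F \<subseteq> Y" "f \<in> polyfun F" "finite G" "G \<subseteq> Y" "g \<in> polyfun G" by blast
  then show ?case by (intro exI[of _ "F \<union> G"]) (auto intro: polyfun.mult polyfun_mono)
qed

lemma polyfun_cong:
  "f \<in> polyfun Y \<Longrightarrow> (\<And>i. i \<in> Y \<Longrightarrow> [z i = z' i] (mod m)) \<Longrightarrow> [f z = f z'] (mod m)"
  by (induction rule: polyfun.induct) (auto intro: cong_add cong_mult)

lemma polyfun_depends: "f \<in> polyfun Y \<Longrightarrow> (\<And>i. i \<in> Y \<Longrightarrow> z i = z' i) \<Longrightarrow> f z = f z'"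
  by (induction rule: polyfun.induct) auto

text \<open>The graph of the homomorphism sending the \<open>i\<close>-th coordinate function to \<open>\<gamma>\<^sub>i\<close>. It is
  well defined because an integer polynomial vanishing on all of \<open>\<int>\<^sup>Y\<close> is formally zero.\<close>
inductive_set subst_graph :: "(nat \<Rightarrow> 'r::comm_ring_1) \<Rightarrow> nat set \<Rightarrow> ('r \<times> ((nat \<Rightarrow> int) \<Rightarrow> int)) set"
  for \<gamma> Y where
  const: "(of_int c, \<lambda>_. c) \<in> subst_graph \<gamma> Y"
| var: "i \<in> Y \<Longrightarrow> (\<gamma> i, \<lambda>z. z i) \<in> subst_graph \<gamma> Y"
| add: "(r, f) \<in> subst_graph \<gamma> Y \<Longrightarrow> (s, g) \<in> subst_graph \<gamma> Y \<Longrightarrow> (r + s, \<lambda>z. f z + g z) \<in> subst_graph \<gamma> Y"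
| mult: "(r, f) \<in> subst_graph \<gamma> Y \<Longrightarrow> (s, g) \<in> subst_graph \<gamma> Y \<Longrightarrow> (r * s, \<lambda>z. f z * g z) \<in> subst_graph \<gamma> Y"

lemma subst_graph_mono: "(r, f) \<in> subst_graph \<gamma> Y \<Longrightarrow> Y \<subseteq> Z \<Longrightarrow> (r, f) \<in> subst_graph \<gamma> Z"
  by (induction rule: subst_graph.induct) (auto intro: subst_graph.intros)

lemma subst_graph_finite: "(r, f) \<in> subst_graph \<gamma> Y \<Longrightarrow> \<exists>F. finite F \<and> (r, f) \<in> subst_graph \<gamma> F"
proof (induction rule: subst_graph.induct)
  case (const c)
  then show ?case by (auto intro!: exI[of _ "{}"] subst_graph.const)
next
  case (var i)
  then show ?case by (auto intro!: exI[of _ "{i}"] subst_graph.var)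
next
  case (add r f s g)
  then obtain F G where "finite F" "(r, f) \<in> subst_graph \<gamma> F" "finite G" "(s, g) \<in> subst_graph \<gamma> G" by blast
  then show ?case by (intro exI[of _ "F \<union> G"]) (auto intro: subst_graph.add subst_graph_mono)
next
  case (mult r f s g)
  then obtain F G where "finite F" "(r, f) \<in> subst_graph \<gamma> F" "finite G" "(s, g) \<in> subst_graph \<gamma> G" by blast
  then show ?case by (intro exI[of _ "F \<union> G"]) (auto intro: subst_graph.mult subst_graph_mono)
qed

lemma subst_graph_polyfun: "(r, f) \<in> subst_graph \<gamma> Y \<Longrightarrow> f \<in> polyfun Y"
  by (induction rule: subst_graph.induct) (auto intro: polyfun.intros)

lemma polyfun_subst_graph: "f \<in> polyfun Y \<Longrightarrow> \<exists>r. (r, f) \<in> subst_graph \<gamma> Y"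
  by (induction rule: polyfun.induct) (auto intro: subst_graph.intros)

lemma subst_graph_sum:
  assumes "\<And>j. j \<in> A \<Longrightarrow> (r j, f j) \<in> subst_graph \<gamma> Y"
  shows "(sum r A, \<lambda>z. \<Sum>j\<in>A. f j z) \<in> subst_graph \<gamma> Y"
  using assms
proof (induction A rule: infinite_finite_induct)
  case (infinite A)
  then show ?case using subst_graph.const[of 0] by simp
next
  case empty
  then show ?case using subst_graph.const[of 0] by simp
next
  case (insert x F)
  then have "(r x + sum r F, \<lambda>z. f x z + (\<Sum>j\<in>F. f j z)) \<in> subst_graph \<gamma> Y"
    by (intro subst_graph.add) auto
  then show ?case using insert.hyps by simp
qed

text \<open>Sorts by powers of one variable on both sides at once: \<open>P\<close> for the
  substituted value and \<open>C z\<close> for the function. Their coefficients are again paired in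
  the graph over the remaining variables, which permits induction on the number of
  variables.\<close>

lemma subst_graph_expand:
  assumes "(r, f) \<in> subst_graph \<gamma> (insert i Y)"
  shows "\<exists>P C. r = poly P (\<gamma> i) \<and> (\<forall>z. f z = poly (C z) (z i)) \<and>
    (\<forall>j. (coeff P j, \<lambda>z. coeff (C z) j) \<in> subst_graph \<gamma> Y)"
  using assms
proof (induction rule: subst_graph.induct)
  case (const c)
  have "(coeff [:of_int c:] j, \<lambda>z. coeff [:c:] j) \<in> subst_graph \<gamma> Y" for j
    using subst_graph.const[of c \<gamma> Y] subst_graph.const[of 0 \<gamma> Y] by (cases j) auto
  then show ?case by (intro exI[of _ "[:of_int c:]"] exI[of _ "\<lambda>_. [:c:]"]) auto
next
  case (var l)
  show ?case
  proof (cases "l = i")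
    case True
    have "(coeff [:0, 1:] j, \<lambda>z. coeff [:0, 1:] j) \<in> subst_graph \<gamma> Y" for j
      using subst_graph.const[of 1 \<gamma> Y] subst_graph.const[of 0 \<gamma> Y]
      by (auto simp: coeff_pCons split: nat.splits)
    then show ?thesis using True by (intro exI[of _ "[:0, 1:]"] exI[of _ "\<lambda>_. [:0, 1:]"]) auto
  next
    case False
    then have "l \<in> Y" using var by auto
    then have "(coeff [:\<gamma> l:] j, \<lambda>z. coeff [:z l:] j) \<in> subst_graph \<gamma> Y" for j
      using subst_graph.var[of l Y \<gamma>] subst_graph.const[of 0 \<gamma> Y] by (cases j) auto
    then show ?thesis by (intro exI[of _ "[:\<gamma> l:]"] exI[of _ "\<lambda>z. [:z l:]"]) auto
  qed
next
  case (add r f s g)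
  obtain P C where 1: "r = poly P (\<gamma> i)" "\<And>z. f z = poly (C z) (z i)"
    "\<And>j. (coeff P j, \<lambda>z. coeff (C z) j) \<in> subst_graph \<gamma> Y"
    using add.IH(1) by blast
  obtain P' C' where 2: "s = poly P' (\<gamma> i)" "\<And>z. g z = poly (C' z) (z i)"
    "\<And>j. (coeff P' j, \<lambda>z. coeff (C' z) j) \<in> subst_graph \<gamma> Y"
    using add.IH(2) by blast
  show ?case
    using 1 2 by (intro exI[of _ "P + P'"] exI[of _ "\<lambda>z. C z + C' z"]) (auto intro: subst_graph.add)
next
  case (mult r f s g)
  obtain P C where 1: "r = poly P (\<gamma> i)" "\<And>z. f z = poly (C z) (z i)"
    "\<And>j. (coeff P j, \<lambda>z. coeff (C z) j) \<in> subst_graph \<gamma> Y"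
    using mult.IH(1) by blast
  obtain P' C' where 2: "s = poly P' (\<gamma> i)" "\<And>z. g z = poly (C' z) (z i)"
    "\<And>j. (coeff P' j, \<lambda>z. coeff (C' z) j) \<in> subst_graph \<gamma> Y"
    using mult.IH(2) by blast
  have "(coeff (P * P') j, \<lambda>z. coeff (C z * C' z) j) \<in> subst_graph \<gamma> Y" for j
    unfolding coeff_mult using 1(3) 2(3) by (intro subst_graph_sum subst_graph.mult)
  then show ?case
    using 1 2 by (intro exI[of _ "P * P'"] exI[of _ "\<lambda>z. C z * C' z"]) auto
qed

text \<open>The coefficients of \<open>C z\<close> do not involve the coordinate \<open>i\<close>,
  so moving that coordinate alone shows that every integer is a root of \<open>C z\<close>. Hence
  \<open>C z = 0\<close>, and the induction hypothesis kills each coefficient of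
  \<open>P\<close>.\<close>

lemma subst_graph_zero:
  assumes "finite Y" "(r, \<lambda>_. 0) \<in> subst_graph \<gamma> Y"
  shows "r = 0"
  using assms
proof (induction Y arbitrary: r rule: finite_induct)
  case empty
  have "(r, f) \<in> subst_graph \<gamma> {} \<Longrightarrow> \<exists>c. r = of_int c \<and> f = (\<lambda>_. c)" for r f
    by (induction rule: subst_graph.induct) (auto simp flip: of_int_add of_int_mult)
  from this[OF empty] show ?case by (auto simp: fun_eq_iff)
next
  case (insert i Y)
  from subst_graph_expand[OF insert.prems] obtain P C where
    PC: "r = poly P (\<gamma> i)" "\<And>z. 0 = poly (C z) (z i)"
      "\<And>j. (coeff P j, \<lambda>z. coeff (C z) j) \<in> subst_graph \<gamma> Y" by blast
  have C: "coeff (C z) j = coeff (C (z(i := t))) j" for z j t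
    by (rule polyfun_depends[OF subst_graph_polyfun[OF PC(3)]]) (use insert.hyps in auto)
  then have "C z = C (z(i := t))" for z t by (simp add: poly_eq_iff)
  then have "poly (C z) t = 0" for z t using PC(2)[of "z(i := t)"] by (metis fun_upd_same)
  then have "C z = 0" for z by (metis poly_all_0_iff_0)
  then have "(coeff P j, \<lambda>z. 0) \<in> subst_graph \<gamma> Y" for j using PC(3)[of j] by simp
  then have "coeff P j = 0" for j by (rule insert.IH)
  then have "P = 0" by (simp add: poly_eq_iff)
  then show ?case using PC(1) by simp
qed

lemma polyfun_minus: "f \<in> polyfun Y \<Longrightarrow> (\<lambda>z. - f z) \<in> polyfun Y"
  using polyfun.mult[OF polyfun.const[of "-1"], of f Y] by simp

text \<open>Zariski density of a residue class: choose a point where one coefficient of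
  \<open>f\<close> and one of \<open>g\<close> are nonzero, then move the last coordinate within its
  infinite residue class, avoiding the finitely many roots of the product. Treating two functions
  together also shows that the polynomial ring is a domain.\<close>

lemma polyfun_common_nonroot:
  assumes "finite Y" "f \<in> polyfun Y" "g \<in> polyfun Y" "f w \<noteq> 0" "g w' \<noteq> 0" "m > 0"
  shows "\<exists>z. (\<forall>i. [z i = b i] (mod m)) \<and> f z \<noteq> 0 \<and> g z \<noteq> 0"
  using assms(1-5)
proof (induction Y arbitrary: f g w w' rule: finite_induct)
  case empty
  then have "f b \<noteq> 0" "g b \<noteq> 0" using polyfun_depends by (metis empty_iff)+
  then show ?case by (intro exI[of _ b]) auto
next
  case (insert i Y)
  have expand: "\<exists>C. (\<forall>z. h z = poly (C z) (z i)) \<and> (\<forall>j. (\<lambda>z. coeff (C z) j) \<in> polyfun Y)"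
    if h: "h \<in> polyfun (insert i Y)" for h
  proof -
    \<comment> \<open>Any substitution serves here; only the function half of the expansion is
      wanted.\<close>
    obtain r where "(r :: int, h) \<in> subst_graph (\<lambda>_. 0) (insert i Y)"
      using polyfun_subst_graph[OF h] by blast
    from subst_graph_expand[OF this] show ?thesis using subst_graph_polyfun by blast
  qed
  obtain C where C: "\<And>z. f z = poly (C z) (z i)" "\<And>j. (\<lambda>z. coeff (C z) j) \<in> polyfun Y"
    using expand[OF insert.prems(1)] by blast
  obtain D where D: "\<And>z. g z = poly (D z) (z i)" "\<And>j. (\<lambda>z. coeff (D z) j) \<in> polyfun Y"
    using expand[OF insert.prems(2)] by blast
  obtain j where j: "coeff (C w) j \<noteq> 0" using C(1)[of w] insert.prems(3) by (metis poly_0 poly_eqI coeff_0)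
  obtain l where l: "coeff (D w') l \<noteq> 0" using D(1)[of w'] insert.prems(4) by (metis poly_0 poly_eqI coeff_0)
  obtain z where z: "\<And>i. [z i = b i] (mod m)" "coeff (C z) j \<noteq> 0" "coeff (D z) l \<noteq> 0"
    using insert.IH[OF C(2) D(2) j l] by blast
  have nz: "C z * D z \<noteq> 0" using z(2,3) by auto
  define T where "T = range (\<lambda>q::nat. b i + m * int q)"
  have "infinite T" unfolding T_def using \<open>m > 0\<close> by (intro range_inj_infinite) (auto simp: inj_def)
  then obtain t where t: "t \<in> T" "poly (C z * D z) t \<noteq> 0"
    using poly_roots_finite[OF nz] by (metis (mono_tags, lifting) infinite_super mem_Collect_eq subsetI)
  have "coeff (C (z(i := t))) j = coeff (C z) j" "coeff (D (z(i := t))) j = coeff (D z) j" for j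
    by (rule polyfun_depends[OF C(2)] polyfun_depends[OF D(2)]; use insert.hyps in auto)+
  then have eq: "C (z(i := t)) = C z" "D (z(i := t)) = D z" by (auto simp: poly_eq_iff)
  have "[t = b i] (mod m)" using t(1) by (auto simp: T_def cong_def)
  then have "\<forall>l. [(z(i := t)) l = b l] (mod m)" using z(1) by auto
  moreover have "f (z(i := t)) \<noteq> 0" "g (z(i := t)) \<noteq> 0" using t(2) unfolding C(1) D(1) eq by auto
  ultimately show ?case by blast
qed

text \<open>The polynomial ring \<open>\<int>[x\<^sub>0, x\<^sub>1, \<dots>]\<close>, realised by its functions on integer points.\<close>
typedef zpoly = "polyfun UNIV" morphisms zeval Zpoly
  using polyfun.const by blast

setup_lifting type_definition_zpoly

instantiation zpoly :: comm_ring_1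
begin
lift_definition zero_zpoly :: zpoly is "\<lambda>_. 0" by (rule polyfun.const)
lift_definition one_zpoly :: zpoly is "\<lambda>_. 1" by (rule polyfun.const)
lift_definition plus_zpoly :: "zpoly \<Rightarrow> zpoly \<Rightarrow> zpoly" is "\<lambda>f g z. f z + g z" by (rule polyfun.add)
lift_definition times_zpoly :: "zpoly \<Rightarrow> zpoly \<Rightarrow> zpoly" is "\<lambda>f g z. f z * g z" by (rule polyfun.mult)
lift_definition uminus_zpoly :: "zpoly \<Rightarrow> zpoly" is "\<lambda>f z. - f z" by (rule polyfun_minus)
lift_definition minus_zpoly :: "zpoly \<Rightarrow> zpoly \<Rightarrow> zpoly" is "\<lambda>f g z. f z - g z"
  using polyfun.add[OF _ polyfun_minus] by fastforce
instance
  by standard (transfer; auto simp: algebra_simps fun_eq_iff)+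
end

lemmas zeval_simps [simp] = zero_zpoly.rep_eq one_zpoly.rep_eq plus_zpoly.rep_eq times_zpoly.rep_eq
  uminus_zpoly.rep_eq minus_zpoly.rep_eq

lemma zpoly_eq_iff: "f = g \<longleftrightarrow> (\<forall>z. zeval f z = zeval g z)"
  by (simp add: zeval_inject[symmetric] fun_eq_iff)

lemma zpoly_common_nonroot:
  assumes "f \<noteq> 0" "g \<noteq> 0" "m > 0"
  shows "\<exists>z. (\<forall>i. [z i = b i] (mod m)) \<and> zeval f z \<noteq> 0 \<and> zeval g z \<noteq> 0"
proof -
  obtain w w' where w: "zeval f w \<noteq> 0" "zeval g w' \<noteq> 0" using assms by (auto simp: zpoly_eq_iff)
  obtain F G where "finite F" "zeval f \<in> polyfun F" "finite G" "zeval g \<in> polyfun G"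
    using polyfun_finite[OF zeval] by metis
  then have "zeval f \<in> polyfun (F \<union> G)" "zeval g \<in> polyfun (F \<union> G)" "finite (F \<union> G)"
    by (auto intro: polyfun_mono)
  then show ?thesis
    using polyfun_common_nonroot[where f = "zeval f" and g = "zeval g" and b = b] w \<open>m > 0\<close> by blast
qed

instance zpoly :: idom
proof
  fix f g :: zpoly
  assume "f \<noteq> 0" "g \<noteq> 0"
  then obtain z where "zeval f z \<noteq> 0" "zeval g z \<noteq> 0"
    using zpoly_common_nonroot[of f g 1] by auto
  then show "f * g \<noteq> 0" by (auto simp: zpoly_eq_iff)
qed

lemma zeval_of_int [simp]: "zeval (of_int c) z = c"
proof -
  have "zeval (of_nat n) z = int n" for n by (induction n) auto
  then show ?thesis by (cases c) (auto simp del: of_nat_Suc)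
qed

lemma zeval_sum [simp]: "zeval (sum f A) z = (\<Sum>i\<in>A. zeval (f i) z)"
  by (induction A rule: infinite_finite_induct) auto

section \<open>The subring of polynomials in a given set of variables\<close>

definition zvars :: "nat set \<Rightarrow> zpoly set" where
  "zvars Y = {f. zeval f \<in> polyfun Y}"

lift_definition zX :: "nat \<Rightarrow> zpoly" is "\<lambda>i z. z i"
  by (rule polyfun.var) simp

lemma zvars_of_int [intro, simp]: "of_int c \<in> zvars Y"
proof -
  have "zeval (of_int c) = (\<lambda>_. c)" by (simp add: fun_eq_iff)
  then show ?thesis unfolding zvars_def using polyfun.const[of c Y] by simp
qed

lemma zvars_0 [intro, simp]: "0 \<in> zvars Y" and zvars_1 [intro, simp]: "1 \<in> zvars Y"
  using zvars_of_int[of 0 Y] zvars_of_int[of 1 Y] by auto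

lemma zvars_X [intro]: "i \<in> Y \<Longrightarrow> zX i \<in> zvars Y"
  unfolding zvars_def by (auto simp: zX.rep_eq intro: polyfun.var)

lemma zvars_add [intro]: "f \<in> zvars Y \<Longrightarrow> g \<in> zvars Y \<Longrightarrow> f + g \<in> zvars Y"
  unfolding zvars_def by (auto simp: plus_zpoly.rep_eq intro: polyfun.add)

lemma zvars_mult [intro]: "f \<in> zvars Y \<Longrightarrow> g \<in> zvars Y \<Longrightarrow> f * g \<in> zvars Y"
  unfolding zvars_def by (auto simp: times_zpoly.rep_eq intro: polyfun.mult)

lemma zvars_uminus [intro]: "f \<in> zvars Y \<Longrightarrow> - f \<in> zvars Y"
  unfolding zvars_def by (auto simp: uminus_zpoly.rep_eq intro: polyfun_minus)

lemma zvars_induct [consumes 1, case_names const var add mult]: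
  assumes "f \<in> zvars Y"
    and const: "\<And>c. P (of_int c)"
    and var: "\<And>i. i \<in> Y \<Longrightarrow> P (zX i)"
    and add: "\<And>f g. f \<in> zvars Y \<Longrightarrow> g \<in> zvars Y \<Longrightarrow> P f \<Longrightarrow> P g \<Longrightarrow> P (f + g)"
    and mult: "\<And>f g. f \<in> zvars Y \<Longrightarrow> g \<in> zvars Y \<Longrightarrow> P f \<Longrightarrow> P g \<Longrightarrow> P (f * g)"
  shows "P f"
proof -
  have "\<exists>h. zeval h = F \<and> h \<in> zvars Y \<and> P h" if "F \<in> polyfun Y" for F
    using that
  proof (induction rule: polyfun.induct)
    case (const c)
    then show ?case using assms(2) by (intro exI[of _ "of_int c"]) (auto simp: fun_eq_iff)
  next
    case (var i)
    then show ?case using assms(3) by (intro exI[of _ "zX i"]) (auto simp: zX.rep_eq)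
  next
    case (add F G)
    then show ?case using assms(4) by (metis plus_zpoly.rep_eq zvars_add)
  next
    case (mult F G)
    then show ?case using assms(5) by (metis times_zpoly.rep_eq zvars_mult)
  qed
  then show ?thesis using assms(1) unfolding zvars_def by (metis mem_Collect_eq zeval_inject)
qed

lemma zvars_empty: "f \<in> zvars {} \<Longrightarrow> \<exists>c. f = of_int c"
  by (induction rule: zvars_induct) (auto simp flip: of_int_add of_int_mult)

lemma zvars_insert_expand:
  assumes "f \<in> zvars (insert i Y)"
  shows "\<exists>P. f = poly P (zX i) \<and> (\<forall>j. coeff P j \<in> zvars Y)"
  using assms
proof (induction rule: zvars_induct)
  case (const c)
  then show ?case by (intro exI[of _ "[:of_int c:]"]) (auto simp: coeff_pCons split: nat.splits)
next
  case (var l)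
  show ?case
  proof (cases "l = i")
    case True
    then show ?thesis by (intro exI[of _ "[:0, 1:]"]) (auto simp: coeff_pCons split: nat.splits)
  next
    case False
    then show ?thesis using var by (intro exI[of _ "[:zX l:]"]) (auto simp: coeff_pCons split: nat.splits)
  qed
next
  case (add f g)
  then obtain P Q where "f = poly P (zX i)" "\<forall>j. coeff P j \<in> zvars Y" "g = poly Q (zX i)" "\<forall>j. coeff Q j \<in> zvars Y"
    by blast
  then show ?case by (intro exI[of _ "P + Q"]) auto
next
  case (mult f g)
  then obtain P Q where PQ: "f = poly P (zX i)" "\<forall>j. coeff P j \<in> zvars Y" "g = poly Q (zX i)" "\<forall>j. coeff Q j \<in> zvars Y"
    by blast
  have sum: "sum h A \<in> zvars Y" if "\<And>j. h j \<in> zvars Y" for h and A :: "nat set"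
    using that by (induction A rule: infinite_finite_induct) auto
  have "coeff (P * Q) j \<in> zvars Y" for j
    unfolding coeff_mult using PQ by (intro sum) auto
  then show ?case using PQ by (intro exI[of _ "P * Q"]) auto
qed

text \<open>The graph is single-valued: two values over one polynomial differ by a value over the
  zero function. Its derivation involves only finitely many variables, so
  \<open>subst_graph_zero\<close> applies.\<close>

lemma zpoly_substitution:
  fixes \<gamma> :: "nat \<Rightarrow> 'r::comm_ring_1"
  shows "\<exists>\<Phi>. \<Phi> 1 = 1 \<and> (\<forall>f g. \<Phi> (f + g) = \<Phi> f + \<Phi> g) \<and> (\<forall>f g. \<Phi> (f * g) = \<Phi> f * \<Phi> g) \<and>
    (\<forall>c. \<Phi> (of_int c) = of_int c) \<and> (\<forall>i. \<Phi> (zX i) = \<gamma> i)"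
proof -
  have uniq: "r = s" if "(r, f) \<in> subst_graph \<gamma> UNIV" "(s, f) \<in> subst_graph \<gamma> UNIV" for r s f
  proof -
    have "(r + of_int (- 1) * s, \<lambda>z. f z + (- 1) * f z) \<in> subst_graph \<gamma> UNIV"
      by (intro subst_graph.add subst_graph.mult subst_graph.const that)
    then have "(r - s, \<lambda>_. 0) \<in> subst_graph \<gamma> UNIV" by simp
    then have "r - s = 0" using subst_graph_finite subst_graph_zero by blast
    then show ?thesis by simp
  qed
  define \<Phi> where "\<Phi> f = (THE r. (r, zeval f) \<in> subst_graph \<gamma> UNIV)" for f
  have eq: "\<Phi> f = r" if "(r, zeval f) \<in> subst_graph \<gamma> UNIV" for f r
    unfolding \<Phi>_def using uniq that by blast
  have in_graph: "(\<Phi> f, zeval f) \<in> subst_graph \<gamma> UNIV" for f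
    using polyfun_subst_graph[OF zeval, where \<gamma> = \<gamma>] eq by metis
  have "\<Phi> (f + g) = \<Phi> f + \<Phi> g" "\<Phi> (f * g) = \<Phi> f * \<Phi> g" for f g
    by (intro eq; simp only: plus_zpoly.rep_eq times_zpoly.rep_eq; intro subst_graph.add subst_graph.mult in_graph)+
  moreover have of_int: "\<Phi> (of_int c) = of_int c" for c
  proof -
    have "zeval (of_int c) = (\<lambda>_. c)" by (simp add: fun_eq_iff)
    then show ?thesis using eq subst_graph.const by metis
  qed
  moreover have "\<Phi> 1 = 1" using of_int[of 1] by simp
  moreover have "\<Phi> (zX i) = \<gamma> i" for i
    by (intro eq) (simp add: zX.rep_eq subst_graph.var)
  ultimately show ?thesis by blast
qed

section \<open>Integrality of endomorphisms of finitely generated modules\<close>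

definition is_subring :: "'a::comm_ring_1 set \<Rightarrow> bool" where
  "is_subring P \<longleftrightarrow> 0 \<in> P \<and> 1 \<in> P \<and> (\<forall>x\<in>P. - x \<in> P) \<and> (\<forall>x\<in>P. \<forall>y\<in>P. x + y \<in> P \<and> x * y \<in> P)"

lemma is_subringD:
  assumes "is_subring P"
  shows "0 \<in> P" "1 \<in> P" "x \<in> P \<Longrightarrow> - x \<in> P" "x \<in> P \<Longrightarrow> y \<in> P \<Longrightarrow> x + y \<in> P"
    "x \<in> P \<Longrightarrow> y \<in> P \<Longrightarrow> x * y \<in> P"
  using assms unfolding is_subring_def by auto

lemma is_subring_sum: "is_subring P \<Longrightarrow> (\<And>x. x \<in> A \<Longrightarrow> f x \<in> P) \<Longrightarrow> sum f A \<in> P"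
  by (induction A rule: infinite_finite_induct) (auto simp: is_subringD)

lemma is_subring_prod: "is_subring P \<Longrightarrow> (\<And>x. x \<in> A \<Longrightarrow> f x \<in> P) \<Longrightarrow> prod f A \<in> P"
  by (induction A rule: infinite_finite_induct) (auto simp: is_subringD)

lemma is_subring_poly: "is_subring P \<Longrightarrow> is_subring {f. \<forall>i. coeff f i \<in> P}"
  unfolding is_subring_def[of "{f. _ f}"]
  by (auto simp: is_subringD coeff_mult one_pCons coeff_pCons intro!: is_subring_sum split: nat.splits)

lemma is_subring_det:
  assumes "is_subring P" "A \<in> carrier_mat n n" "\<And>i j. i < n \<Longrightarrow> j < n \<Longrightarrow> A $$ (i, j) \<in> P"
  shows "det A \<in> P"
proof -
  have "signof q \<in> P" for q :: "nat \<Rightarrow> nat"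
    using assms(1) by (auto simp: sign_def is_subringD)
  moreover have "(\<Prod>i = 0..<n. A $$ (i, q i)) \<in> P" if "q permutes {0..<n}" for q
    using assms(3) permutes_in_image[OF that] by (intro is_subring_prod[OF assms(1)]) auto
  ultimately show ?thesis
    unfolding det_def'[OF assms(2)]
    by (intro is_subring_sum[OF assms(1)] is_subringD(5)[OF assms(1)]) auto
qed

text \<open>The polynomials with all coefficients in \<open>P\<close> form a subring, which contains
  the entries of the characteristic matrix and therefore its determinant.\<close>

lemma is_subring_char_poly:
  assumes P: "is_subring P" and A: "A \<in> carrier_mat n n" "\<And>i j. i < n \<Longrightarrow> j < n \<Longrightarrow> A $$ (i, j) \<in> P"
  shows "coeff (char_poly A) l \<in> P"
proof -
  have "char_poly A \<in> {f. \<forall>i. coeff f i \<in> P}"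
    unfolding char_poly_def
  proof (rule is_subring_det[OF is_subring_poly[OF P] char_poly_matrix_closed[OF A(1)]])
    fix i j assume "i < n" "j < n"
    then show "char_poly_matrix A $$ (i, j) \<in> {f. \<forall>i. coeff f i \<in> P}"
      using A is_subringD[OF P] unfolding char_poly_matrix_def
      by (auto simp: coeff_pCons split: nat.splits)
  qed
  then show ?thesis by simp
qed

locale module_endo = Modules.module scale
  for scale :: "'a::comm_ring_1 \<Rightarrow> 'b::ab_group_add \<Rightarrow> 'b" (infixr \<open>*s\<close> 75) +
  fixes \<phi> :: "'b \<Rightarrow> 'b"
  assumes endo_add: "\<phi> (x + y) = \<phi> x + \<phi> y"
    and endo_scale: "\<phi> (c *s x) = c *s \<phi> x"
begin

lemma endo_zero: "\<phi> 0 = 0"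
  using endo_add[of 0 0] by simp

lemma endo_sum: "\<phi> (sum f A) = (\<Sum>x\<in>A. \<phi> (f x))"
  by (induction A rule: infinite_finite_induct) (auto simp: endo_zero endo_add)

text \<open>The module structure over the polynomial ring in which the variable acts as
  \<open>\<phi>\<close>.\<close>

definition act :: "'a poly \<Rightarrow> 'b \<Rightarrow> 'b" where
  "act f x = (\<Sum>i\<le>degree f. coeff f i *s (\<phi> ^^ i) x)"

lemma act_bound: "degree f \<le> n \<Longrightarrow> act f x = (\<Sum>i\<le>n. coeff f i *s (\<phi> ^^ i) x)"
  unfolding act_def by (intro sum.mono_neutral_left) (auto simp: coeff_eq_0)

lemma act_0 [simp]: "act 0 x = 0"
  by (simp add: act_def)

lemma act_add: "act (f + g) x = act f x + act g x"
proof -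
  define n where "n = max (degree f) (degree g)"
  show ?thesis
    using act_bound[of f n x] act_bound[of g n x] act_bound[of "f + g" n x] degree_add_le_max[of f g]
    by (simp add: n_def algebra_simps sum.distrib)
qed

lemma act_pCons: "act (pCons c f) x = c *s x + \<phi> (act f x)"
  by (subst act_bound[OF degree_pCons_le], subst sum.atMost_Suc_shift)
    (simp add: act_def endo_sum endo_scale)

lemma act_smult: "act (smult c f) x = c *s act f x"
  by (induction f) (simp_all add: act_pCons endo_scale algebra_simps)

lemma act_mult: "act (f * g) x = act f (act g x)"
  by (induction f) (simp_all add: act_pCons act_add act_smult)

lemma act_right_add: "act f (x + y) = act f x + act f y"
  by (induction f) (simp_all add: act_pCons endo_add algebra_simps)

lemma act_right_zero [simp]: "act f 0 = 0"
  by (induction f) (simp_all add: act_pCons endo_zero)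

lemma act_right_sum: "act f (sum h A) = (\<Sum>x\<in>A. act f (h x))"
  by (induction A rule: infinite_finite_induct) (auto simp: act_right_add)

lemma act_left_sum: "act (sum h A) x = (\<Sum>i\<in>A. act (h i) x)"
  by (induction A rule: infinite_finite_induct) (auto simp: act_add)

text \<open>The Cayley-Hamilton argument by adjugates: over the polynomial ring the characteristic
  matrix kills the vector \<open>u\<close>, hence so does its product with its adjugate, which is
  the characteristic polynomial times the identity.\<close>

lemma act_char_poly:
  assumes A: "A \<in> carrier_mat m m"
    and u: "\<And>j. j < m \<Longrightarrow> \<phi> (u j) = (\<Sum>i<m. A $$ (j, i) *s u i)"
    and k: "k < m"
  shows "act (char_poly A) (u k) = 0"
proof -
  let ?C = "char_poly_matrix A"
  have C: "?C \<in> carrier_mat m m" using A by simp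
  have zero: "(\<Sum>i<m. act (?C $$ (j, i)) (u i)) = 0" if "j < m" for j
  proof -
    have "act (?C $$ (j, i)) (u i) = (if i = j then \<phi> (u i) else 0) - A $$ (j, i) *s u i" if "i < m" for i
      using that \<open>j < m\<close> A by (auto simp: char_poly_matrix_def act_pCons endo_zero one_pCons)
    then have "(\<Sum>i<m. act (?C $$ (j, i)) (u i)) =
        (\<Sum>i<m. (if i = j then \<phi> (u i) else 0) - A $$ (j, i) *s u i)" by simp
    also have "\<dots> = 0" using u[OF that] that by (simp add: sum_subtractf)
    finally show ?thesis .
  qed
  have "act (char_poly A) (u k) = (\<Sum>i<m. act ((char_poly A \<cdot>\<^sub>m 1\<^sub>m m) $$ (k, i)) (u i))"
  proof -
    have "(\<Sum>i<m. act ((char_poly A \<cdot>\<^sub>m 1\<^sub>m m) $$ (k, i)) (u i)) =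
        (\<Sum>i<m. if i = k then act (char_poly A) (u i) else 0)"
      using k by (intro sum.cong) auto
    then show ?thesis using k by simp
  qed
  also have "\<dots> = (\<Sum>i<m. act ((adj_mat ?C * ?C) $$ (k, i)) (u i))"
    unfolding char_poly_def adj_mat(3)[OF C] ..
  also have "\<dots> = (\<Sum>i<m. act (\<Sum>j<m. adj_mat ?C $$ (k, j) * ?C $$ (j, i)) (u i))"
    using adj_mat(1)[OF C] C k by (intro sum.cong) (auto simp: scalar_prod_def lessThan_atLeast0)
  also have "\<dots> = (\<Sum>j<m. act (adj_mat ?C $$ (k, j)) (\<Sum>i<m. act (?C $$ (j, i)) (u i)))"
    by (simp add: act_left_sum act_mult act_right_sum) (rule sum.swap)
  also have "\<dots> = 0" using zero by simp
  finally show ?thesis .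
qed

end

text \<open>Scalars range over a subset \<open>P\<close> only, so that spans over different subrings
  can be compared inside one module.\<close>

inductive_set pspan :: "('a \<Rightarrow> 'b::ab_group_add \<Rightarrow> 'b) \<Rightarrow> 'a set \<Rightarrow> 'b set \<Rightarrow> 'b set"
  for scale P U where
  zero: "0 \<in> pspan scale P U"
| step: "u \<in> U \<Longrightarrow> c \<in> P \<Longrightarrow> x \<in> pspan scale P U \<Longrightarrow> scale c u + x \<in> pspan scale P U"

lemma pspan_add: "x \<in> pspan scale P U \<Longrightarrow> y \<in> pspan scale P U \<Longrightarrow> x + y \<in> pspan scale P U"
  by (induction rule: pspan.induct) (auto intro: pspan.intros simp: add.assoc)

lemma pspan_mono: "x \<in> pspan scale P U \<Longrightarrow> P \<subseteq> Q \<Longrightarrow> U \<subseteq> V \<Longrightarrow> x \<in> pspan scale Q V"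
  by (induction rule: pspan.induct) (auto intro: pspan.intros)

lemma pspan_sum: "(\<And>i. i \<in> A \<Longrightarrow> f i \<in> pspan scale P U) \<Longrightarrow> sum f A \<in> pspan scale P U"
  by (induction A rule: infinite_finite_induct) (auto intro: pspan.zero pspan_add)

context Modules.module
begin

lemma pspan_scale:
  assumes "x \<in> pspan scale P U" "is_subring P" "c \<in> P"
  shows "scale c x \<in> pspan scale P U"
  using assms
proof (induction rule: pspan.induct)
  case zero
  then show ?case by (simp add: pspan.zero)
next
  case (step u d x)
  then show ?case by (auto simp: scale_right_distrib intro!: pspan.step is_subringD(5))
qed

lemma pspan_gen: "u \<in> U \<Longrightarrow> c \<in> P \<Longrightarrow> scale c u \<in> pspan scale P U"
  using pspan.step[OF _ _ pspan.zero, of u U c P scale] by simp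

lemma pspan_coeffs:
  assumes "x \<in> pspan scale P U" "is_subring P" "finite U"
  shows "\<exists>c. (\<forall>u. c u \<in> P) \<and> x = (\<Sum>u\<in>U. scale (c u) u)"
  using assms
proof (induction rule: pspan.induct)
  case zero
  then show ?case by (intro exI[of _ "\<lambda>_. 0"]) (auto simp: is_subringD)
next
  case (step u d x)
  then obtain c where c: "\<And>u. c u \<in> P" "x = (\<Sum>u\<in>U. scale (c u) u)" by blast
  have "(\<Sum>v\<in>U. scale ((c(u := d + c u)) v) v) =
      (\<Sum>v\<in>U. (if v = u then scale d u else 0) + scale (c v) v)"
    by (intro sum.cong) (auto simp: scale_left_distrib)
  also have "\<dots> = scale d u + x" using step c by (simp add: sum.distrib)
  finally show ?case using c step by (intro exI[of _ "c(u := d + c u)"]) (auto simp: is_subringD)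
qed

end

context module_endo
begin

text \<open>On the generators \<open>U\<close> the map \<open>\<phi>\<close> is given by a matrix
  over \<open>P\<close>. Its characteristic polynomial is monic with coefficients in
  \<open>P\<close> and kills every generator.\<close>

lemma endo_pspan_integral:
  assumes P: "is_subring P" and "finite U"
    and \<phi>: "\<And>u. u \<in> U \<Longrightarrow> \<phi> u \<in> pspan scale P U" and "w \<in> U"
  shows "\<exists>D c. (\<forall>i. c i \<in> P) \<and> (\<phi> ^^ D) w = (\<Sum>i<D. c i *s (\<phi> ^^ i) w)"
proof -
  define m where "m = card U"
  obtain h where h: "bij_betw h {..<m} U"
    using ex_bij_betw_nat_finite[OF \<open>finite U\<close>] unfolding m_def by (auto simp: lessThan_atLeast0)
  have "\<forall>u\<in>U. \<exists>c. (\<forall>v. c v \<in> P) \<and> \<phi> u = (\<Sum>v\<in>U. c v *s v)"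
    using pspan_coeffs[OF \<phi> P \<open>finite U\<close>] by blast
  then obtain c where c: "\<And>u v. u \<in> U \<Longrightarrow> c u v \<in> P" "\<And>u. u \<in> U \<Longrightarrow> \<phi> u = (\<Sum>v\<in>U. c u v *s v)"
    by metis
  define A where "A = mat m m (\<lambda>(j, i). c (h j) (h i))"
  have A: "A \<in> carrier_mat m m" by (simp add: A_def)
  have hU: "h j \<in> U" if "j < m" for j using h that by (auto simp: bij_betw_def)
  have "\<phi> (h j) = (\<Sum>i<m. A $$ (j, i) *s h i)" if "j < m" for j
    unfolding c(2)[OF hU[OF that]] A_def using that
    by (subst sum.reindex_bij_betw[OF h, symmetric]) simp
  moreover obtain k where k: "k < m" "h k = w" using h \<open>w \<in> U\<close> by (auto simp: bij_betw_def)
  ultimately have zero: "act (char_poly A) w = 0" using act_char_poly[OF A, of h k] by blast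
  have deg: "degree (char_poly A) = m" "coeff (char_poly A) m = 1" using degree_monic_char_poly[OF A] by auto
  have "act (char_poly A) w = (\<phi> ^^ m) w + (\<Sum>i<m. coeff (char_poly A) i *s (\<phi> ^^ i) w)"
    unfolding act_def deg lessThan_Suc_atMost[symmetric] by (simp add: deg)
  with zero have "(\<phi> ^^ m) w = - (\<Sum>i<m. coeff (char_poly A) i *s (\<phi> ^^ i) w)"
    by (simp add: eq_neg_iff_add_eq_0)
  then have "(\<phi> ^^ m) w = (\<Sum>i<m. (- coeff (char_poly A) i) *s (\<phi> ^^ i) w)"
    by (simp add: sum_negf)
  moreover have "- coeff (char_poly A) i \<in> P" for i
    using is_subring_char_poly[OF P A] c(1) hU by (intro is_subringD(3)[OF P]) (auto simp: A_def)
  ultimately show ?thesis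
    by (intro exI[of _ m] exI[of _ "\<lambda>i. - coeff (char_poly A) i"]) simp
qed

end

section \<open>Elimination of algebraic variables\<close>

lemma is_subring_zvars: "is_subring (zvars Y)"
  unfolding is_subring_def by auto

lemma zvars_power [intro]: "f \<in> zvars Y \<Longrightarrow> f ^ n \<in> zvars Y"
  by (induction n) auto

lemma (in Modules.module) pspan_invariant:
  assumes "x \<in> pspan scale P U" "is_subring P" "\<And>u. u \<in> U \<Longrightarrow> scale r u \<in> pspan scale P U'"
  shows "scale r x \<in> pspan scale P U'"
  using assms(1)
proof (induction rule: pspan.induct)
  case zero
  then show ?case by (simp add: pspan.zero)
next
  case (step u c x)
  have "scale c (scale r u) \<in> pspan scale P U'"
    by (rule pspan_scale[OF assms(3)[OF step.hyps(1)] assms(2) step.hyps(2)])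
  then show ?case using step.IH by (simp add: scale_right_distrib mult.commute pspan_add)
qed

locale zpoly_module_endo = module_endo scale \<phi>
  for scale :: "zpoly \<Rightarrow> 'b::ab_group_add \<Rightarrow> 'b" (infixr \<open>*s\<close> 75) and \<phi>
begin

text \<open>Monomials of small degree in the algebraic variables span, up to denominators from \<open>\<int>[Y]\<close>,
  a \<open>\<int>[Y]\<close>-module stable under these variables.\<close>
lemma finite_stable_family:
  assumes "finite I" "I \<subseteq> V" "Y \<subseteq> V"
    and rec: "(\<phi> ^^ d) a = (\<Sum>j<d. c j *s (\<phi> ^^ j) a)" "\<And>j. c j \<in> zvars V"
    and indep: "\<And>q. q \<in> zvars Y \<Longrightarrow> q \<noteq> 0 \<Longrightarrow> q *s a \<noteq> 0"
    and alg: "\<And>i. i \<in> I \<Longrightarrow> \<exists>q\<in>zvars (insert i Y). q \<noteq> 0 \<and> q *s a = 0"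
  shows "\<exists>U. finite U \<and> a \<in> U \<and> (\<forall>u\<in>U. \<forall>q. q *s a = 0 \<longrightarrow> q *s u = 0) \<and>
    (\<forall>u\<in>U. \<phi> u \<in> pspan scale (zvars V) U) \<and>
    (\<forall>i\<in>I. \<exists>l\<in>zvars Y. l \<noteq> 0 \<and> (\<forall>u\<in>U. (l * zX i) *s u \<in> pspan scale (zvars Y) U))"
  using assms(1,2) alg
proof (induction I rule: finite_induct)
  case empty
  have d: "d > 0"
  proof (rule ccontr)
    assume "\<not> d > 0"
    then have "a = 0" using rec(1) by simp
    then show False using indep[of 1] by auto
  qed
  define U where "U = (\<lambda>j. (\<phi> ^^ j) a) ` {..<d}"
  have "q *s (\<phi> ^^ j) a = (\<phi> ^^ j) (q *s a)" for q j
    by (induction j) (auto simp flip: endo_scale)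
  moreover have "(\<phi> ^^ j) 0 = 0" for j by (induction j) (auto simp: endo_zero)
  ultimately have "\<forall>u\<in>U. \<forall>q. q *s a = 0 \<longrightarrow> q *s u = 0" by (auto simp: U_def)
  moreover have "\<phi> u \<in> pspan scale (zvars V) U" if "u \<in> U" for u
  proof -
    from that obtain j where j: "j < d" "u = (\<phi> ^^ j) a" by (auto simp: U_def)
    show ?thesis
    proof (cases "Suc j < d")
      case True
      then have "\<phi> u \<in> U" unfolding U_def j by (intro image_eqI[of _ _ "Suc j"]) auto
      then show ?thesis using pspan_gen[of "\<phi> u" U 1 "zvars V"] by simp
    next
      case False
      then have "Suc j = d" using j by simp
      then have "\<phi> u = (\<phi> ^^ d) a" using j by auto
      then show ?thesis unfolding rec(1)
        by (auto intro!: pspan_sum pspan_gen rec(2) simp: U_def)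
    qed
  qed
  moreover have "a \<in> U" using d unfolding U_def by (intro image_eqI[of _ _ 0]) auto
  ultimately show ?case by (intro exI[of _ U]) (auto simp: U_def)
next
  case (insert i I)
  then obtain U where U: "finite U" "a \<in> U" "\<And>u q. u \<in> U \<Longrightarrow> q *s a = 0 \<Longrightarrow> q *s u = 0"
    "\<And>u. u \<in> U \<Longrightarrow> \<phi> u \<in> pspan scale (zvars V) U"
    "\<And>i. i \<in> I \<Longrightarrow> \<exists>l\<in>zvars Y. l \<noteq> 0 \<and> (\<forall>u\<in>U. (l * zX i) *s u \<in> pspan scale (zvars Y) U)"
    by (metis insert_subset insertCI)
  obtain q where q: "q \<in> zvars (insert i Y)" "q \<noteq> 0" "q *s a = 0" using insert.prems(2) by blast
  obtain P where P: "q = poly P (zX i)" "\<And>j. coeff P j \<in> zvars Y"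
    using zvars_insert_expand[OF q(1)] by blast
  have "P \<noteq> 0" using P(1) q(2) by auto
  define E where "E = degree P"
  define m where "m = lead_coeff P"
  have m: "m \<in> zvars Y" "m \<noteq> 0" using P(2) \<open>P \<noteq> 0\<close> by (auto simp: m_def)
  \<comment> \<open>A constant \<open>P\<close> would be a nonzero element of \<open>zvars Y\<close>
    killing \<open>a\<close>, contrary to independence.\<close>
  have E: "E > 0"
  proof (rule ccontr)
    assume "\<not> E > 0"
    then have "q = m" unfolding P(1) m_def E_def by (auto elim!: degree_eq_zeroE)
    then show False using indep[OF m] q(3) by simp
  qed
  have qE: "q = (\<Sum>j<E. coeff P j * zX i ^ j) + m * zX i ^ E"
    unfolding P(1) poly_altdef E_def m_def lessThan_Suc_atMost[symmetric] by simp
  define U' where "U' = (\<lambda>(e, u). zX i ^ e *s u) ` ({..<E} \<times> U)"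
  have U'I: "zX i ^ e *s u \<in> U'" if "e < E" "u \<in> U" for e u
    using that unfolding U'_def by auto
  have U'E: "\<exists>e u. e < E \<and> u \<in> U \<and> x = zX i ^ e *s u" if "x \<in> U'" for x
    using that unfolding U'_def by auto
  have UU': "U \<subseteq> U'" using U'I[OF E] by force
  have lift: "zX i ^ e *s x \<in> pspan scale Q U'" if "e < E" "x \<in> pspan scale Q U" "is_subring Q" for e x Q
    using that(2,3)
  proof (rule pspan_invariant)
    fix u assume "u \<in> U"
    then show "zX i ^ e *s u \<in> pspan scale Q U'"
      using pspan_gen[OF U'I[OF that(1)], of u 1 Q] is_subringD(2)[OF that(3)] by simp
  qed
  have "finite U'" using U(1) by (auto simp: U'_def)
  moreover have "a \<in> U'" using U(2) UU' by blast
  moreover have "r *s u = 0" if "u \<in> U'" "r *s a = 0" for u r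
  proof -
    from U'E[OF that(1)] obtain e v where "v \<in> U" "u = zX i ^ e *s v" by blast
    then have "r *s u = zX i ^ e *s (r *s v)" by (simp add: mult.commute)
    then show ?thesis using U(3)[OF \<open>v \<in> U\<close> that(2)] by simp
  qed
  moreover have "\<phi> u \<in> pspan scale (zvars V) U'" if "u \<in> U'" for u
  proof -
    from U'E[OF that(1)] obtain e v where v: "v \<in> U" "u = zX i ^ e *s v" by blast
    have "\<phi> u = zX i ^ e *s \<phi> v" by (simp add: v endo_scale)
    moreover have "\<phi> v \<in> pspan scale (zvars V) U'" using pspan_mono[OF U(4)[OF v(1)] _ UU'] by blast
    ultimately show ?thesis
      using pspan_scale[OF _ is_subring_zvars zvars_power[OF zvars_X]] insert.prems(1) by simp
  qed
  moreover have "\<exists>l\<in>zvars Y. l \<noteq> 0 \<and> (\<forall>u\<in>U'. (l * zX j) *s u \<in> pspan scale (zvars Y) U')"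
    if "j \<in> insert i I" for j
  proof (cases "j = i")
    case False
    then obtain l where l: "l \<in> zvars Y" "l \<noteq> 0" "\<And>u. u \<in> U \<Longrightarrow> (l * zX j) *s u \<in> pspan scale (zvars Y) U"
      using U(5)[of j] \<open>j \<in> insert i I\<close> by auto
    have "(l * zX j) *s u \<in> pspan scale (zvars Y) U'" if "u \<in> U'" for u
    proof -
      from U'E[OF that(1)] obtain e v where v: "e < E" "v \<in> U" "u = zX i ^ e *s v" by blast
      have "(l * zX j) *s u = zX i ^ e *s ((l * zX j) *s v)" using v by (simp add: mult.commute)
      then show ?thesis using lift[OF v(1) l(3)[OF v(2)] is_subring_zvars] by simp
    qed
    then show ?thesis using l by blast
  next
    case True
    \<comment> \<open>The leading coefficient \<open>m\<close> is the denominator for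
      \<open>zX i\<close>: once the exponent reaches \<open>E\<close>, the relation
      \<open>q *s v = 0\<close> rewrites \<open>m * zX i ^ E\<close> by lower powers.\<close>
    have "(m * zX i) *s u \<in> pspan scale (zvars Y) U'" if "u \<in> U'" for u
    proof -
      from U'E[OF that(1)] obtain e v where v: "e < E" "v \<in> U" "u = zX i ^ e *s v" by blast
      have eq: "(m * zX i) *s u = m *s (zX i ^ Suc e *s v)" using v by (simp add: mult_ac)
      show ?thesis
      proof (cases "Suc e < E")
        case True
        then show ?thesis unfolding eq using v(2) m(1) by (intro pspan_gen U'I)
      next
        case False
        then have "Suc e = E" using v by simp
        then have "(m * zX i) *s u = (m * zX i ^ E) *s v" unfolding eq by simp
        also have "\<dots> = q *s v - (\<Sum>j<E. coeff P j * zX i ^ j) *s v"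
          unfolding qE by (simp add: scale_left_distrib)
        also have "\<dots> = (\<Sum>j<E. (- coeff P j) *s (zX i ^ j *s v))"
          using U(3)[OF v(2) q(3)] by (simp add: scale_sum_left sum_negf)
        also have "\<dots> \<in> pspan scale (zvars Y) U'"
          using v(2) P(2) by (intro pspan_sum pspan_gen U'I) auto
        finally show ?thesis .
      qed
    qed
    then show ?thesis using m True by blast
  qed
  ultimately show ?case by (intro exI[of _ U']) blast
qed

text \<open>Scaling the \<open>n\<close>-th term by \<open>l\<^sup>n\<close> clears the denominators, so the new recurrence stays monic.\<close>
lemma recurrence_over_independent_variables:
  assumes "finite V" "Y \<subseteq> V"
    and rec: "(\<phi> ^^ d) a = (\<Sum>j<d. c j *s (\<phi> ^^ j) a)" "\<And>j. c j \<in> zvars V"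
    and indep: "\<And>q. q \<in> zvars Y \<Longrightarrow> q \<noteq> 0 \<Longrightarrow> q *s a \<noteq> 0"
    and alg: "\<And>i. i \<in> V - Y \<Longrightarrow> \<exists>q\<in>zvars (insert i Y). q \<noteq> 0 \<and> q *s a = 0"
  shows "\<exists>l\<in>zvars Y. l \<noteq> 0 \<and> (\<exists>D g. (\<forall>i. g i \<in> zvars Y) \<and>
    ((\<lambda>x. l *s \<phi> x) ^^ D) a = (\<Sum>i<D. g i *s ((\<lambda>x. l *s \<phi> x) ^^ i) a))"
proof -
  have fin: "finite (V - Y)" using assms(1) by simp
  from finite_stable_family[OF fin Diff_subset assms(2) rec indep alg]
  obtain U where U: "finite U" "a \<in> U" "\<And>u. u \<in> U \<Longrightarrow> \<phi> u \<in> pspan scale (zvars V) U"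
    "\<And>i. i \<in> V - Y \<Longrightarrow> \<exists>l\<in>zvars Y. l \<noteq> 0 \<and> (\<forall>u\<in>U. (l * zX i) *s u \<in> pspan scale (zvars Y) U)"
    by blast
  \<comment> \<open>Denominators of sums and products are products of denominators, and these stay
    nonzero in a domain.\<close>
  have stable: "\<exists>l\<in>zvars Y. l \<noteq> 0 \<and> (\<forall>u\<in>U. (l * f) *s u \<in> pspan scale (zvars Y) U)" if "f \<in> zvars V" for f
    using that
  proof (induction rule: zvars_induct)
    case (const c)
    then show ?case by (intro bexI[of _ 1]) (auto intro: pspan_gen)
  next
    case (var i)
    show ?case
    proof (cases "i \<in> Y")
      case True
      then show ?thesis by (intro bexI[of _ 1]) (auto intro!: pspan_gen zvars_X)
    next
      case False
      then show ?thesis using U(4) var by blast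
    qed
  next
    case (add f g)
    from add.IH(1) obtain l where
      l: "l \<in> zvars Y" "l \<noteq> 0" "\<And>u. u \<in> U \<Longrightarrow> (l * f) *s u \<in> pspan scale (zvars Y) U" by blast
    from add.IH(2) obtain m where
      m: "m \<in> zvars Y" "m \<noteq> 0" "\<And>u. u \<in> U \<Longrightarrow> (m * g) *s u \<in> pspan scale (zvars Y) U" by blast
    note lm = l m
    have "(l * m * (f + g)) *s u \<in> pspan scale (zvars Y) U" if "u \<in> U" for u
    proof -
      have "(l * m * (f + g)) *s u = m *s ((l * f) *s u) + l *s ((m * g) *s u)"
        by (simp add: scale_left_distrib distrib_left mult_ac)
      then show ?thesis
        by (simp only:) (intro pspan_add pspan_scale is_subring_zvars lm that)
    qed
    then show ?case using lm by (intro bexI[of _ "l * m"]) auto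
  next
    case (mult f g)
    from mult.IH(1) obtain l where
      l: "l \<in> zvars Y" "l \<noteq> 0" "\<And>u. u \<in> U \<Longrightarrow> (l * f) *s u \<in> pspan scale (zvars Y) U" by blast
    from mult.IH(2) obtain m where
      m: "m \<in> zvars Y" "m \<noteq> 0" "\<And>u. u \<in> U \<Longrightarrow> (m * g) *s u \<in> pspan scale (zvars Y) U" by blast
    note lm = l m
    have "(l * m * (f * g)) *s u \<in> pspan scale (zvars Y) U" if "u \<in> U" for u
    proof -
      have "(l * m * (f * g)) *s u = (l * f) *s ((m * g) *s u)"
        by (simp add: mult_ac)
      then show ?thesis using pspan_invariant[OF lm(6)[OF that] is_subring_zvars lm(3)] by simp
    qed
    then show ?case using lm by (intro bexI[of _ "l * m"]) auto
  qed
  have stable': "\<exists>l\<in>zvars Y. l \<noteq> 0 \<and> l *s x \<in> pspan scale (zvars Y) U" if "x \<in> pspan scale (zvars V) U" for x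
    using that
  proof (induction rule: pspan.induct)
    case zero
    then show ?case by (intro bexI[of _ 1]) (auto intro: pspan.zero)
  next
    case (step u c x)
    then obtain l where l: "l \<in> zvars Y" "l \<noteq> 0" "l *s x \<in> pspan scale (zvars Y) U" by blast
    from stable[OF step.hyps(2)] obtain m where
      m: "m \<in> zvars Y" "m \<noteq> 0" "(m * c) *s u \<in> pspan scale (zvars Y) U"
      using step.hyps(1) by blast
    have "(l * m) *s (c *s u + x) = l *s ((m * c) *s u) + m *s (l *s x)"
      by (simp add: scale_right_distrib mult_ac)
    also have "\<dots> \<in> pspan scale (zvars Y) U"
      by (intro pspan_add pspan_scale[OF l(3)] pspan_scale[OF m(3)] is_subring_zvars l(1) m(1))
    finally show ?case using l m by (intro bexI[of _ "l * m"]) auto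
  qed
  have "\<exists>l\<in>zvars Y. l \<noteq> 0 \<and> (\<forall>u\<in>W. l *s \<phi> u \<in> pspan scale (zvars Y) U)" if "finite W" "W \<subseteq> U" for W
    using that
  proof (induction W rule: finite_induct)
    case empty
    then show ?case by (intro bexI[of _ 1]) auto
  next
    case (insert w W)
    then obtain l where l: "l \<in> zvars Y" "l \<noteq> 0" "\<And>u. u \<in> W \<Longrightarrow> l *s \<phi> u \<in> pspan scale (zvars Y) U" by blast
    have "\<phi> w \<in> pspan scale (zvars V) U" using U(3) insert.prems by simp
    from stable'[OF this] obtain m where
      m: "m \<in> zvars Y" "m \<noteq> 0" "m *s \<phi> w \<in> pspan scale (zvars Y) U" by blast
    have "(l * m) *s \<phi> u \<in> pspan scale (zvars Y) U" if "u \<in> insert w W" for u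
    proof (cases "u = w")
      case True
      have "l *s (m *s \<phi> w) \<in> pspan scale (zvars Y) U"
        by (rule pspan_scale[OF m(3) is_subring_zvars l(1)])
      then show ?thesis using True by simp
    next
      case False
      then have "m *s (l *s \<phi> u) \<in> pspan scale (zvars Y) U"
        using that by (intro pspan_scale[OF l(3) is_subring_zvars m(1)]) simp
      then show ?thesis by (simp add: mult.commute)
    qed
    then show ?case using l m by (intro bexI[of _ "l * m"]) auto
  qed
  from this[OF U(1) subset_refl] obtain l where l: "l \<in> zvars Y" "l \<noteq> 0"
    "\<And>u. u \<in> U \<Longrightarrow> l *s \<phi> u \<in> pspan scale (zvars Y) U" by blast
  \<comment> \<open>Unlike \<open>\<phi>\<close>, the map \<open>l *s \<phi> x\<close> sends every
    generator into the span over \<open>zvars Y\<close>, so the integrality lemma yields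
    coefficients in \<open>zvars Y\<close>.\<close>
  interpret l: module_endo scale "\<lambda>x. l *s \<phi> x"
    by unfold_locales (simp_all add: endo_add endo_scale scale_right_distrib mult.commute)
  show ?thesis
    using l.endo_pspan_integral[OF is_subring_zvars U(1) l(3) U(2)] l(1,2) by blast
qed

end

section \<open>Zeros modulo torsion\<close>

text \<open>A non-torsion element stays non-torsion modulo a maximal saturated submodule avoiding it, and
  the quotient then has rank one. This replaces a linear functional into the fraction field.\<close>
lemma (in Modules.module) rank_one_quotient:
  fixes P :: "'a set"
  assumes P: "is_subring P" and idom: "\<And>x y. x \<in> P \<Longrightarrow> y \<in> P \<Longrightarrow> x * y = 0 \<Longrightarrow> x = 0 \<or> y = 0"
    and one: "(1 :: 'a) \<noteq> 0"
    and w: "\<And>q. q \<in> P \<Longrightarrow> q \<noteq> 0 \<Longrightarrow> scale q w \<noteq> 0"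
  shows "\<exists>T. (\<forall>x\<in>T. \<forall>y\<in>T. x + y \<in> T) \<and> (\<forall>c\<in>P. \<forall>x\<in>T. scale c x \<in> T) \<and> 0 \<in> T \<and>
    (\<forall>c\<in>P. c \<noteq> 0 \<longrightarrow> scale c w \<notin> T) \<and>
    (\<forall>m. \<exists>t\<in>P. t \<noteq> 0 \<and> (\<exists>c\<in>P. scale t m - scale c w \<in> T))"
proof -
  note Pd = is_subringD[OF P]
  have nz: "x * y \<noteq> 0" if "x \<in> P" "y \<in> P" "x \<noteq> 0" "y \<noteq> 0" for x y using idom that by blast
  \<comment> \<open>Saturated \<open>P\<close>-submodules avoiding \<open>w\<close>, to which Zorn's
    lemma is applied; \<open>sat T m\<close> below is the saturation of
    \<open>T + P m\<close>.\<close>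
  define good where "good T \<longleftrightarrow> 0 \<in> T \<and> (\<forall>x\<in>T. \<forall>y\<in>T. x + y \<in> T) \<and> (\<forall>c\<in>P. \<forall>x\<in>T. scale c x \<in> T) \<and>
    (\<forall>c\<in>P. \<forall>x. c \<noteq> 0 \<longrightarrow> scale c x \<in> T \<longrightarrow> x \<in> T) \<and> w \<notin> T" for T
  define sat where "sat T m = {x. \<exists>t\<in>P. t \<noteq> 0 \<and> (\<exists>c\<in>P. scale t x - scale c m \<in> T)}" for T m
  have sat: "0 \<in> sat T m \<and> (\<forall>x\<in>sat T m. \<forall>y\<in>sat T m. x + y \<in> sat T m) \<and>
      (\<forall>c\<in>P. \<forall>x\<in>sat T m. scale c x \<in> sat T m) \<and>
      (\<forall>c\<in>P. \<forall>x. c \<noteq> 0 \<longrightarrow> scale c x \<in> sat T m \<longrightarrow> x \<in> sat T m)"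
    if T: "0 \<in> T" "\<And>x y. x \<in> T \<Longrightarrow> y \<in> T \<Longrightarrow> x + y \<in> T" "\<And>c x. c \<in> P \<Longrightarrow> x \<in> T \<Longrightarrow> scale c x \<in> T" for T m
  proof (intro conjI ballI allI impI)
    show "0 \<in> sat T m"
      unfolding sat_def using Pd(1,2) one T(1) by (intro CollectI bexI[of _ 1] conjI bexI[of _ 0]) auto
  next
    fix x y assume "x \<in> sat T m" "y \<in> sat T m"
    then obtain t c t' c' where *: "t \<in> P" "t \<noteq> 0" "c \<in> P" "scale t x - scale c m \<in> T"
      "t' \<in> P" "t' \<noteq> 0" "c' \<in> P" "scale t' y - scale c' m \<in> T" unfolding sat_def by blast
    have "scale t' (scale t x - scale c m) + scale t (scale t' y - scale c' m) \<in> T"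
      by (intro T * )
    then have "scale (t * t') (x + y) - scale (t' * c + t * c') m \<in> T"
      by (simp add: scale_right_distrib scale_left_distrib scale_right_diff_distrib mult_ac add_ac diff_add_eq diff_diff_add add_diff_eq)
    then show "x + y \<in> sat T m"
      unfolding sat_def using * nz Pd(4,5) by (intro CollectI bexI[of _ "t * t'"] conjI bexI[of _ "t' * c + t * c'"]) auto
  next
    fix d x assume d: "d \<in> P" and "x \<in> sat T m"
    then obtain t c where *: "t \<in> P" "t \<noteq> 0" "c \<in> P" "scale t x - scale c m \<in> T" unfolding sat_def by blast
    have "scale d (scale t x - scale c m) \<in> T" by (intro T * d)
    then have "scale t (scale d x) - scale (d * c) m \<in> T" by (simp add: scale_right_diff_distrib mult_ac)
    then show "scale d x \<in> sat T m"
      unfolding sat_def using * d Pd(5) by (intro CollectI bexI[of _ t] conjI bexI[of _ "d * c"]) auto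
  next
    fix d x assume d: "d \<in> P" "d \<noteq> 0" and "scale d x \<in> sat T m"
    then obtain t c where *: "t \<in> P" "t \<noteq> 0" "c \<in> P" "scale t (scale d x) - scale c m \<in> T" unfolding sat_def by blast
    then show "x \<in> sat T m"
      unfolding sat_def using d nz Pd(5) by (intro CollectI bexI[of _ "t * d"] conjI bexI[of _ c]) auto
  qed
  \<comment> \<open>\<open>sat {0} 0\<close> is the torsion submodule, which shows that good sets
    exist.\<close>
  have "w \<notin> sat {0} 0" using w unfolding sat_def by auto
  then have good0: "good (sat {0} 0)" using sat[of "{0}" 0] unfolding good_def by auto
  have "\<exists>M\<in>{T. good T}. \<forall>X\<in>{T. good T}. M \<subseteq> X \<longrightarrow> X = M"
  proof (rule subset_Zorn_nonempty)
    show "{T. good T} \<noteq> {}" using good0 by blast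
  next
    fix C assume C: "C \<noteq> {}" "subset.chain {T. good T} C"
    then have g: "\<And>T. T \<in> C \<Longrightarrow> good T" unfolding subset.chain_def by auto
    have add: "x + y \<in> \<Union>C" if "x \<in> X" "X \<in> C" "y \<in> Y" "Y \<in> C" for x y X Y
    proof -
      have "X \<subseteq> Y \<or> Y \<subseteq> X" using C(2) that unfolding subset.chain_def by blast
      then show ?thesis
      proof
        assume "X \<subseteq> Y"
        then have "x + y \<in> Y" using g[OF that(4)] that unfolding good_def by blast
        then show ?thesis using that(4) by blast
      next
        assume "Y \<subseteq> X"
        then have "x + y \<in> X" using g[OF that(2)] that unfolding good_def by blast
        then show ?thesis using that(2) by blast
      qed
    qed
    have "good (\<Union>C)"
      unfolding good_def
    proof (intro conjI ballI allI impI)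
      show "0 \<in> \<Union>C" using C(1) g unfolding good_def by blast
      show "w \<notin> \<Union>C" using g unfolding good_def by blast
    qed (use add g in \<open>unfold good_def, blast+\<close>)
    then show "\<Union>C \<in> {T. good T}" by simp
  qed
  then obtain T where T: "good T" "\<And>X. good X \<Longrightarrow> T \<subseteq> X \<Longrightarrow> X = T" by auto
  \<comment> \<open>If \<open>w\<close> lies in \<open>sat T m\<close>, the relation found has
    \<open>c \<noteq> 0\<close> because \<open>T\<close> is saturated and avoids \<open>w\<close>.
    Otherwise maximality forces \<open>sat T m = T\<close>, so \<open>m\<close> itself lies in
    \<open>T\<close>.\<close>
  have ex: "\<exists>t\<in>P. t \<noteq> 0 \<and> (\<exists>c\<in>P. scale t m - scale c w \<in> T)" for m
  proof (cases "w \<in> sat T m")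
    case True
    then obtain t c where *: "t \<in> P" "t \<noteq> 0" "c \<in> P" "scale t w - scale c m \<in> T" unfolding sat_def by blast
    have "c \<noteq> 0"
    proof
      assume "c = 0"
      then have "scale t w \<in> T" using * by simp
      then show False using T(1) * unfolding good_def by blast
    qed
    moreover have "scale (- 1) (scale t w - scale c m) \<in> T"
      using T(1) * Pd(2,3) unfolding good_def by blast
    then have "scale c m - scale t w \<in> T" by simp
    ultimately show ?thesis using * by blast
  next
    case False
    then have "good (sat T m)" using sat[of T m] T(1) unfolding good_def by simp
    moreover have "T \<subseteq> sat T m"
      unfolding sat_def using one Pd(1,2)
      by (intro subsetI CollectI bexI[of _ 1] conjI bexI[of _ 0]) auto
    ultimately have "sat T m = T" by (rule T(2))
    moreover have "m \<in> sat T m"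
      unfolding sat_def using one Pd(2) T(1)
      by (intro CollectI bexI[of _ 1] conjI) (auto simp: good_def)
    ultimately have "scale 1 m - scale 0 w \<in> T" by simp
    then show ?thesis using one Pd(1,2) by blast
  qed
  have "\<forall>c\<in>P. c \<noteq> 0 \<longrightarrow> scale c w \<notin> T"
    using T(1) unfolding good_def by blast
  moreover have "\<forall>x\<in>T. \<forall>y\<in>T. x + y \<in> T" "\<forall>c\<in>P. \<forall>x\<in>T. scale c x \<in> T" "0 \<in> T"
    using T(1) unfolding good_def by simp_all
  ultimately show ?thesis using ex by (intro exI[of _ T]) simp
qed

locale zpoly_module = Modules.module scale
  for scale :: "zpoly \<Rightarrow> 'm::ab_group_add \<Rightarrow> 'm" (infixr \<open>*s\<close> 75)
begin

text \<open>A non-torsion value \<open>w\<close> in the class would give a rank one quotient, where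
  \<open>t *s a n\<close> equals \<open>c n *s w\<close> with \<open>c n\<close> in
  \<open>zvars Y\<close>. Evaluating \<open>c\<close> at points congruent to \<open>b\<close> gives
  integer recurrences that vanish on the whole class; by density \<open>c\<close> vanishes there
  too, which puts \<open>t *s w\<close> into \<open>T\<close>, a contradiction.\<close>

lemma recurrence_torsion_classes:
  fixes a :: "nat \<Rightarrow> 'm"
  assumes g: "\<And>i. g i \<in> zvars Y"
    and rec: "\<And>n. a (n + D) = (\<Sum>i<D. g i *s a (n + i))"
    and g0: "D > 0 \<Longrightarrow> g 0 \<noteq> 0"
  shows "\<exists>k>0. \<forall>r. infinite {n. a (r + k * n) = 0} \<longrightarrow>
    (\<forall>n. \<exists>q\<in>zvars Y. q \<noteq> 0 \<and> q *s a (r + k * n) = 0)"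
proof (cases "D = 0")
  case True
  then have "a n = 0" for n using rec[of n] by simp
  then show ?thesis by (intro exI[of _ 1]) (auto intro!: bexI[of _ 1])
next
  case False
  then have "g 0 \<noteq> 0" using g0 by simp
  then obtain b where b: "zeval (g 0) b \<noteq> 0" by (auto simp: zpoly_eq_iff)
  \<comment> \<open>As \<open>p\<close> exceeds the nonzero value of \<open>g 0\<close> at
    \<open>b\<close>, it does not divide the value of \<open>g 0\<close> at any point congruent to
    \<open>b\<close> modulo \<open>p\<close>. The period depends on \<open>p\<close> and
    \<open>D\<close> alone, so one \<open>k\<close> serves all these points and all classes.\<close>
  obtain p where p: "prime p" "p > nat \<bar>zeval (g 0) b\<bar>" using bigger_prime by blast
  have pb: "\<not> int p dvd zeval (g 0) b"
  proof
    assume "int p dvd zeval (g 0) b"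
    then have "int p \<le> \<bar>zeval (g 0) b\<bar>" using b by (metis abs_of_nat dvd_imp_le_int)
    then show False using p(2) by linarith
  qed
  define k :: nat where "k = fact ((p\<^sup>2) ^ D)"
  have "\<exists>q\<in>zvars Y. q \<noteq> 0 \<and> q *s a (r + k * n) = 0" if inf: "infinite {n. a (r + k * n) = 0}" for r n
  proof (rule ccontr)
    define w where "w = a (r + k * n)"
    assume "\<not> ?thesis"
    then have indep: "q *s w \<noteq> 0" if "q \<in> zvars Y" "q \<noteq> 0" for q using that unfolding w_def by blast
    have idom: "x = 0 \<or> y = 0" if "x * y = 0" for x y :: zpoly using that by simp
    have "\<exists>T. (\<forall>x\<in>T. \<forall>y\<in>T. x + y \<in> T) \<and> (\<forall>c\<in>zvars Y. \<forall>x\<in>T. c *s x \<in> T) \<and> 0 \<in> T \<and>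
      (\<forall>c\<in>zvars Y. c \<noteq> 0 \<longrightarrow> c *s w \<notin> T) \<and>
      (\<forall>m. \<exists>t\<in>zvars Y. t \<noteq> 0 \<and> (\<exists>c\<in>zvars Y. t *s m - c *s w \<in> T))" (is "\<exists>T. ?Q T")
      by (rule rank_one_quotient[OF is_subring_zvars idom one_neq_zero indep])
    then obtain T where "?Q T" ..
    then have T: "\<And>x y. x \<in> T \<Longrightarrow> y \<in> T \<Longrightarrow> x + y \<in> T" "\<And>c x. c \<in> zvars Y \<Longrightarrow> x \<in> T \<Longrightarrow> c *s x \<in> T"
      "0 \<in> T" "\<And>c. c \<in> zvars Y \<Longrightarrow> c \<noteq> 0 \<Longrightarrow> c *s w \<notin> T"
      "\<And>m. \<exists>t\<in>zvars Y. t \<noteq> 0 \<and> (\<exists>c\<in>zvars Y. t *s m - c *s w \<in> T)"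
      by simp_all
    have T_sum: "sum f A \<in> T" if "\<And>i. i \<in> A \<Longrightarrow> f i \<in> T" for f and A :: "nat set"
      using that by (induction A rule: infinite_finite_induct) (auto simp: T)
    have T_diff: "x - y \<in> T" if "x \<in> T" "y \<in> T" for x y
    proof -
      have "(- 1) *s y \<in> T" using that by (intro T(2)) auto
      then show ?thesis using T(1)[OF that(1)] by force
    qed
    \<comment> \<open>A common denominator for the first \<open>D\<close> terms suffices: the
      recurrence is monic and introduces no further ones.\<close>
    have "\<exists>t\<in>zvars Y. t \<noteq> 0 \<and> (\<forall>i<N. \<exists>c\<in>zvars Y. t *s a i - c *s w \<in> T)" for N
    proof (induction N)
      case 0
      then show ?case by (intro bexI[of _ 1]) auto
    next
      case (Suc N)
      then obtain t where t: "t \<in> zvars Y" "t \<noteq> 0" "\<And>i. i < N \<Longrightarrow> \<exists>c\<in>zvars Y. t *s a i - c *s w \<in> T" by blast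
      obtain t' c' where t': "t' \<in> zvars Y" "t' \<noteq> 0" "c' \<in> zvars Y" "t' *s a N - c' *s w \<in> T" using T(5) by blast
      have step: "(s * t) *s m - (s * c) *s w \<in> T" if "t *s m - c *s w \<in> T" "s \<in> zvars Y" for s t m c
        using T(2)[OF that(2,1)] by (simp add: scale_right_diff_distrib)
      have "\<exists>c\<in>zvars Y. (t * t') *s a i - c *s w \<in> T" if "i < Suc N" for i
      proof (cases "i = N")
        case True
        then show ?thesis using step[OF t'(4) t(1)] t t' by blast
      next
        case False
        then obtain c where "c \<in> zvars Y" "t *s a i - c *s w \<in> T" using t(3) \<open>i < Suc N\<close> by (metis less_antisym)
        then show ?thesis using step[of t "a i" c t'] t' by (metis mult.commute zvars_mult)
      qed
      then show ?case using t t' by (intro bexI[of _ "t * t'"]) auto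
    qed
    from this[of D] obtain t where t: "t \<in> zvars Y" "t \<noteq> 0" "\<And>i. i < D \<Longrightarrow> \<exists>c\<in>zvars Y. t *s a i - c *s w \<in> T" by blast
    have comb: "t *s a (n + D) - (\<Sum>i<D. g i * c i) *s w \<in> T"
      if "\<And>i. i < D \<Longrightarrow> t *s a (n + i) - c i *s w \<in> T" for n c
    proof -
      have "t *s a (n + D) - (\<Sum>i<D. g i * c i) *s w = (\<Sum>i<D. g i *s (t *s a (n + i) - c i *s w))"
        unfolding rec by (simp add: scale_sum_right scale_sum_left sum_subtractf scale_right_diff_distrib mult.commute)
      then show ?thesis using that by (auto intro!: T_sum T(2) g)
    qed
    have "\<exists>c\<in>zvars Y. t *s a n - c *s w \<in> T" for n
    proof (induction n rule: less_induct)
      case (less n)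
      show ?case
      proof (cases "n < D")
        case True
        then show ?thesis by (rule t(3))
      next
        case False
        then have n: "n = (n - D) + D" by simp
        have "\<forall>i\<in>{..<D}. \<exists>c\<in>zvars Y. t *s a (n - D + i) - c *s w \<in> T" using False by (auto intro!: less)
        then obtain c where c: "\<And>i. i < D \<Longrightarrow> c i \<in> zvars Y \<and> t *s a (n - D + i) - c i *s w \<in> T"
          by (metis lessThan_iff)
        have "(\<Sum>i<D. g i * c i) \<in> zvars Y"
          using c g by (intro is_subring_sum is_subring_zvars zvars_mult) auto
        then show ?thesis using comb[of "n - D" c] c n by metis
      qed
    qed
    then obtain c where c: "\<And>n. c n \<in> zvars Y" "\<And>n. t *s a n - c n *s w \<in> T" by metis
    \<comment> \<open>No nonzero multiple of \<open>w\<close> lies in \<open>T\<close>, so the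
      coefficients are determined. This is how \<open>c\<close> inherits both the recurrence and the
      zeros of \<open>a\<close>.\<close>
    have uniq: "e = e'" if "t *s a n - e *s w \<in> T" "t *s a n - e' *s w \<in> T" "e \<in> zvars Y" "e' \<in> zvars Y" for e e' n
    proof (rule ccontr)
      assume "e \<noteq> e'"
      have "(e' + - e) *s w \<in> T"
        using T_diff[OF that(1,2)] by (simp add: scale_left_diff_distrib)
      moreover have "e' + - e \<in> zvars Y" using that(3,4) by (intro zvars_add zvars_uminus)
      ultimately show False using T(4)[of "e' + - e"] \<open>e \<noteq> e'\<close> by fastforce
    qed
    have c_rec: "c (n + D) = (\<Sum>i<D. g i * c (n + i))" for n
      using c g by (intro uniq[of "n + D"] comb is_subring_sum is_subring_zvars zvars_mult)
    have c_zero: "c n = 0" if "a n = 0" for n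
      by (rule uniq[OF c(2)[of n] _ c(1) zvars_0]) (simp add: that T(3))
    have "c (r + k * n) = 0"
    proof (rule ccontr)
      assume "c (r + k * n) \<noteq> 0"
      then obtain z where z: "\<And>i. [z i = b i] (mod int p)" "zeval (c (r + k * n)) z \<noteq> 0"
        using zpoly_common_nonroot[of "c (r + k * n)" "c (r + k * n)" "int p" b] p(1) by (auto simp: prime_gt_0_nat)
      have "[zeval (g 0) z = zeval (g 0) b] (mod int p)"
        by (rule polyfun_cong[OF zeval]) (rule z)
      then have "\<not> int p dvd zeval (g 0) z" using pb by (simp add: cong_dvd_iff)
      moreover have "zeval (c (n + D)) z = (\<Sum>i<D. zeval (g i) z * zeval (c (n + i)) z)" for n
        by (simp add: c_rec)
      moreover have "infinite {n. zeval (c (r + k * n)) z = 0}"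
        using inf by (rule infinite_super[rotated]) (auto simp: c_zero)
      ultimately have "zeval (c (r + k * n)) z = 0"
        using integer_recurrence_zeros[OF p(1), of "\<lambda>i. zeval (g i) z" "\<lambda>n. zeval (c n) z" D r n]
        unfolding k_def by blast
      then show False using z(2) by simp
    qed
    then have "t *s w \<in> T" using c(2)[of "r + k * n"] unfolding w_def by simp
    then show False using T(4)[OF t(1,2)] by blast
  qed
  moreover have "k > 0" by (simp add: k_def)
  ultimately show ?thesis by blast
qed

end

section \<open>Zero sets\<close>

definition eventually_periodic_set :: "nat set \<Rightarrow> bool" where
  "eventually_periodic_set S \<longleftrightarrow> (\<exists>F P. finite F \<and> finite P \<and> (\<forall>(m, n)\<in>P. n > 0) \<and>
           S = F \<union> (\<Union>(m, n)\<in>P. arith_prog m n))"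

section \<open>Closure properties of finite unions of points and progressions\<close>

lemma eventually_periodic_set_finite: "finite S \<Longrightarrow> eventually_periodic_set S"
  unfolding eventually_periodic_set_def by (intro exI[of _ S] exI[of _ "{}"]) auto

lemma eventually_periodic_set_UNIV: "eventually_periodic_set UNIV"
  unfolding eventually_periodic_set_def
  by (intro exI[of _ "{}"] exI[of _ "{(0, 1)}"]) (auto simp: arith_prog_def)

lemma eventually_periodic_set_Un:
  assumes "eventually_periodic_set S" "eventually_periodic_set S'"
  shows "eventually_periodic_set (S \<union> S')"
proof -
  obtain F P where 1: "finite F" "finite P" "\<forall>(m, n)\<in>P. n > 0" "S = F \<union> (\<Union>(m, n)\<in>P. arith_prog m n)"
    using assms(1) unfolding eventually_periodic_set_def by blast
  obtain F' P' where 2: "finite F'" "finite P'" "\<forall>(m, n)\<in>P'. n > 0" "S' = F' \<union> (\<Union>(m, n)\<in>P'. arith_prog m n)"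
    using assms(2) unfolding eventually_periodic_set_def by blast
  show ?thesis
    unfolding eventually_periodic_set_def using 1 2
    by (intro exI[of _ "F \<union> F'"] exI[of _ "P \<union> P'"]) auto
qed

lemma eventually_periodic_set_UN:
  "finite A \<Longrightarrow> (\<And>x. x \<in> A \<Longrightarrow> eventually_periodic_set (S x)) \<Longrightarrow> eventually_periodic_set (\<Union>x\<in>A. S x)"
  by (induction A rule: finite_induct) (auto intro: eventually_periodic_set_Un eventually_periodic_set_finite)

lemma eventually_periodic_set_affine:
  assumes "eventually_periodic_set S" "k > 0"
  shows "eventually_periodic_set ((\<lambda>n. c + k * n) ` S)"
proof -
  obtain F P where 1: "finite F" "finite P" "\<forall>(m, n)\<in>P. n > 0" "S = F \<union> (\<Union>(m, n)\<in>P. arith_prog m n)"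
    using assms(1) unfolding eventually_periodic_set_def by blast
  have "arith_prog m n = range (\<lambda>j. m + n * j)" for m n
    by (auto simp: arith_prog_def)
  then have eq: "(\<lambda>n. c + k * n) ` arith_prog m n = arith_prog (c + k * m) (k * n)" for m n
    by (simp add: image_image algebra_simps)
  define P' where "P' = (\<lambda>(m, n). (c + k * m, k * n)) ` P"
  have "finite P'" using 1 by (simp add: P'_def)
  moreover have "\<forall>(m, n)\<in>P'. n > 0" using 1(3) assms(2) by (auto simp: P'_def)
  moreover have "(\<lambda>n. c + k * n) ` S = (\<lambda>n. c + k * n) ` F \<union> (\<Union>(m, n)\<in>P. (\<lambda>n. c + k * n) ` arith_prog m n)"
    unfolding 1(4) by auto
  then have "(\<lambda>n. c + k * n) ` S = (\<lambda>n. c + k * n) ` F \<union> (\<Union>(m, n)\<in>P'. arith_prog m n)"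
    unfolding eq by (auto simp: P'_def)
  ultimately show ?thesis
    unfolding eventually_periodic_set_def using 1(1) by blast
qed

lemma sum_fun_apply: "(sum f A) x = (\<Sum>i\<in>A. f i x)" for f :: "'i \<Rightarrow> 'c \<Rightarrow> 'b::ab_group_add"
  by (induction A rule: infinite_finite_induct) auto

context zpoly_module
begin

definition linrec :: "zpoly set \<Rightarrow> (nat \<Rightarrow> 'm) \<Rightarrow> bool" where
  "linrec P a \<longleftrightarrow> (\<exists>d c. (\<forall>i. c i \<in> P) \<and> (\<forall>n. a (n + d) = (\<Sum>i<d. c i *s a (n + i))))"

text \<open>In the module of sequences a recurrence is a relation between iterates of the shift, so
  the results on endomorphisms apply to it.\<close>

lemma seq_endo: "zpoly_module_endo (\<lambda>q u n. q *s (u n :: 'm)) (\<lambda>u n. u (n + k))"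
  by unfold_locales (auto simp: fun_eq_iff scale_left_distrib scale_right_distrib)

lemma funpow_shift: "((\<lambda>u n. u (n + k)) ^^ i) u n = u (n + k * i)" for u :: "nat \<Rightarrow> 'm"
  by (induction i arbitrary: n) (auto simp: algebra_simps)

text \<open>Shifting by \<open>k\<close> preserves the finitely generated span of the shifts of \<open>a\<close>, hence is integral on it.\<close>
lemma linrec_subsequence:
  assumes P: "is_subring P" and "linrec P a"
  shows "linrec P (\<lambda>n. a (r + k * n))"
proof -
  obtain d c where c: "\<And>i. c i \<in> P" "\<And>n. a (n + d) = (\<Sum>i<d. c i *s a (n + i))"
    using assms(2) unfolding linrec_def by blast
  show ?thesis
  proof (cases "d = 0")
    case True
    then have "a n = 0" for n using c(2)[of n] by simp
    then show ?thesis using is_subringD(1)[OF P] unfolding linrec_def by (intro exI[of _ 0]) auto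
  next
    case False
    let ?sc = "\<lambda>q (u :: nat \<Rightarrow> 'm) n. q *s u n"
    interpret seq: zpoly_module_endo ?sc "\<lambda>u n. u (n + k)" by (rule seq_endo)
    define U where "U = (\<lambda>j n. a (n + j)) ` {..<d}"
    have span: "(\<lambda>n. a (n + m)) \<in> pspan ?sc P U" for m
    proof (induction m rule: less_induct)
      case (less m)
      show ?case
      proof (cases "m < d")
        case True
        then have "(\<lambda>n. a (n + m)) \<in> U" by (auto simp: U_def)
        from seq.pspan_gen[OF this is_subringD(2)[OF P]] show ?thesis by simp
      next
        case False
        have "(\<lambda>n. a (n + m)) = (\<Sum>i<d. ?sc (c i) (\<lambda>n. a (n + (m - d + i))))"
        proof
          fix n
          have "n + m = (n + (m - d)) + d" using False by simp
          then show "a (n + m) = (\<Sum>i<d. ?sc (c i) (\<lambda>n. a (n + (m - d + i)))) n"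
            unfolding sum_fun_apply using c(2)[of "n + (m - d)"] by (simp add: add_ac)
        qed
        moreover have "m - d + i < m" if "i < d" for i using False that by simp
        ultimately show ?thesis
          by (simp only:) (intro pspan_sum seq.pspan_scale P c(1) less, simp)
      qed
    qed
    have aU: "a \<in> U" unfolding U_def using False by (intro image_eqI[of _ _ 0]) auto
    have shift: "(\<lambda>n. u (n + k)) \<in> pspan ?sc P U" if "u \<in> U" for u
      using that span[of "k + _"] by (auto simp: U_def add.assoc)
    have "\<exists>D e. (\<forall>i. e i \<in> P) \<and>
        ((\<lambda>u n. u (n + k)) ^^ D) a = (\<Sum>i<D. ?sc (e i) (((\<lambda>u n. u (n + k)) ^^ i) a))"
      by (rule seq.endo_pspan_integral[OF P _ shift aU]) (auto simp: U_def)
    then obtain D e where e: "\<forall>i. e i \<in> P"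
      "((\<lambda>u n. u (n + k)) ^^ D) a = (\<Sum>i<D. ?sc (e i) (((\<lambda>u n. u (n + k)) ^^ i) a))"
      by (elim exE conjE)
    have ev: "a (n + k * D) = (\<Sum>i<D. e i *s a (n + k * i))" for n
      using fun_cong[OF e(2), of n] unfolding sum_fun_apply funpow_shift .
    have "a (r + k * (n + D)) = (\<Sum>i<D. e i *s a (r + k * (n + i)))" for n
      using ev[of "r + k * n"] by (simp only: distrib_left add.assoc)
    then show ?thesis using e(1) unfolding linrec_def by blast
  qed
qed

definition independent_sets :: "nat set \<Rightarrow> (nat \<Rightarrow> 'm) \<Rightarrow> nat set set" where
  "independent_sets V a = {Y. Y \<subseteq> V \<and> (\<forall>q\<in>zvars Y. q \<noteq> 0 \<longrightarrow> (\<exists>n. q *s a n \<noteq> 0))}"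

text \<open>The product of annihilators of the first \<open>d\<close> values is nonzero in a domain,
  and the recurrence carries it to all later values.\<close>

lemma linrec_common_annihilator:
  assumes "linrec P a" "\<And>n. \<exists>q\<in>zvars Y. q \<noteq> 0 \<and> q *s a n = 0"
  shows "\<exists>q\<in>zvars Y. q \<noteq> 0 \<and> (\<forall>n. q *s a n = 0)"
proof -
  obtain d c where c: "\<And>n. a (n + d) = (\<Sum>i<d. c i *s a (n + i))"
    using assms(1) unfolding linrec_def by blast
  have "\<exists>q\<in>zvars Y. q \<noteq> 0 \<and> (\<forall>n<N. q *s a n = 0)" for N
  proof (induction N)
    case 0
    then show ?case by (intro bexI[of _ 1]) auto
  next
    case (Suc N)
    then obtain q where q: "q \<in> zvars Y" "q \<noteq> 0" "\<And>n. n < N \<Longrightarrow> q *s a n = 0" by blast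
    obtain r where r: "r \<in> zvars Y" "r \<noteq> 0" "r *s a N = 0" using assms(2) by blast
    have "(q * r) *s a n = 0" if "n < Suc N" for n
    proof (cases "n = N")
      case True
      then show ?thesis using r by (simp flip: scale_scale)
    next
      case False
      then have "(r * q) *s a n = 0" using q that by (simp flip: scale_scale)
      then show ?thesis by (simp add: mult.commute)
    qed
    then show ?case using q r by (intro bexI[of _ "q * r"]) auto
  qed
  from this[of d] obtain q where q: "q \<in> zvars Y" "q \<noteq> 0" "\<And>n. n < d \<Longrightarrow> q *s a n = 0" by blast
  have "q *s a n = 0" for n
  proof (induction n rule: less_induct)
    case (less n)
    show ?case
    proof (cases "n < d")
      case False
      then have "q *s a n = q *s a ((n - d) + d)" by simp
      also have "\<dots> = (\<Sum>i<d. c i *s (q *s a (n - d + i)))"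
        unfolding c by (simp add: scale_sum_right mult.commute)
      also have "\<dots> = 0" using False by (intro sum.neutral) (auto simp: less)
      finally show ?thesis .
    qed (use q in auto)
  qed
  then show ?thesis using q by blast
qed

text \<open>The measure drops on each class with infinitely many zeros: the subsequence
  \<open>b\<close> is killed by a nonzero element of \<open>zvars Y\<close>, so \<open>Y\<close>
  leaves the family. No set enters it, since the values of \<open>b\<close> are values of
  \<open>a\<close>. Hypothesis \<open>tf\<close> settles the case of an empty family.\<close>

lemma linrec_zero_set:
  assumes tf: "\<And>c m. c \<noteq> 0 \<Longrightarrow> of_int c *s m = 0 \<Longrightarrow> m = 0"
    and V: "finite V" and "linrec (zvars V) a"
  shows "eventually_periodic_set {n. a n = 0}"
  using assms(3)
proof (induction "card (independent_sets V a)" arbitrary: a rule: less_induct)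
  case less
  have fin: "finite (independent_sets V a)" for a
    using V by (auto simp: independent_sets_def intro: finite_subset[of _ "Pow V"])
  show ?case
  proof (cases "independent_sets V a = {}")
    case True
    then have "{} \<notin> independent_sets V a" by simp
    then obtain q where q: "q \<in> zvars {}" "q \<noteq> 0" "\<And>n. q *s a n = 0"
      unfolding independent_sets_def by auto
    obtain c where c: "q = of_int c" using zvars_empty[OF q(1)] by blast
    then have "c \<noteq> 0" using q(2) by (intro notI) simp
    then have "a n = 0" for n using tf[of c "a n"] q(3) c by simp
    then show ?thesis using eventually_periodic_set_UNIV by simp
  next
    case False
    obtain Y where Y: "Y \<in> independent_sets V a" "\<And>X. X \<in> independent_sets V a \<Longrightarrow> Y \<subseteq> X \<Longrightarrow> Y = X"
      using finite_has_maximal[OF fin False] by auto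
    have YV: "Y \<subseteq> V" using Y(1) by (simp add: independent_sets_def)
    let ?sc = "\<lambda>q (u :: nat \<Rightarrow> 'm) n. q *s u n" and ?sh = "\<lambda>(u :: nat \<Rightarrow> 'm) n. u (n + 1)"
    interpret seq: zpoly_module_endo ?sc ?sh by (rule seq_endo)
    obtain d c where c: "\<And>i. c i \<in> zvars V" "\<And>n. a (n + d) = (\<Sum>i<d. c i *s a (n + i))"
      using less.prems unfolding linrec_def by blast
    have shift_rec: "(?sh ^^ d) a = (\<Sum>j<d. ?sc (c j) ((?sh ^^ j) a))"
      by (rule ext) (simp only: sum_fun_apply funpow_shift c(2) mult_1)
    have indep: "?sc q a \<noteq> 0" if "q \<in> zvars Y" "q \<noteq> 0" for q
      using Y(1) that unfolding independent_sets_def fun_eq_iff by auto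
    have alg: "\<exists>q\<in>zvars (insert i Y). q \<noteq> 0 \<and> ?sc q a = 0" if "i \<in> V - Y" for i
    proof -
      have "insert i Y \<notin> independent_sets V a" using Y(2)[of "insert i Y"] that by blast
      moreover have "insert i Y \<subseteq> V" using that YV by blast
      ultimately obtain q where "q \<in> zvars (insert i Y)" "q \<noteq> 0" "\<And>n. q *s a n = 0"
        unfolding independent_sets_def by blast
      then show ?thesis by (intro bexI[of _ q]) (auto simp: fun_eq_iff)
    qed
    have "\<exists>l\<in>zvars Y. l \<noteq> 0 \<and> (\<exists>D g. (\<forall>i. g i \<in> zvars Y) \<and>
        ((\<lambda>x. ?sc l (?sh x)) ^^ D) a = (\<Sum>i<D. ?sc (g i) (((\<lambda>x. ?sc l (?sh x)) ^^ i) a)))"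
      by (rule seq.recurrence_over_independent_variables[OF V YV shift_rec c(1) indep alg])
    then obtain l D g where l: "l \<in> zvars Y" "l \<noteq> 0" and g: "\<And>i. g i \<in> zvars Y"
      and rec: "((\<lambda>x. ?sc l (?sh x)) ^^ D) a = (\<Sum>i<D. ?sc (g i) (((\<lambda>x. ?sc l (?sh x)) ^^ i) a))"
      by (elim bexE exE conjE) (rule that; simp)
    have pow: "((\<lambda>x. ?sc l (?sh x)) ^^ i) u n = l ^ i *s u (n + i)" for i u n
      by (induction i arbitrary: n) (auto simp: mult_ac)
    have rec': "l ^ D *s a (n + D) = (\<Sum>i<D. g i *s (l ^ i *s a (n + i)))" for n
      using fun_cong[OF rec, of n] unfolding sum_fun_apply pow .
    \<comment> \<open>Discarding the first \<open>j\<close> terms makes the last coefficient of the recurrence nonzero.\<close>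
    define j where "j = (LEAST j. j = D \<or> g j \<noteq> 0)"
    have j: "j = D \<or> g j \<noteq> 0" unfolding j_def by (rule LeastI[of _ D]) simp
    have j_le: "j \<le> D" unfolding j_def by (rule Least_le) simp
    have j_min: "g i = 0" if "i < j" for i using not_less_Least[of i] that unfolding j_def by blast
    define a' where "a' n = l ^ (n + j) *s a (n + j)" for n
    have rec'': "a' (n + (D - j)) = (\<Sum>i<D - j. g (i + j) *s a' (n + i))" for n
    proof -
      \<comment> \<open>The factor \<open>l ^ n\<close> turns \<open>rec'\<close> into a relation
        between terms of \<open>a'\<close> whose coefficients do not depend on
        \<open>n\<close>.\<close>
      have "a' (n + (D - j)) = l ^ n *s (l ^ D *s a (n + D))"
        using j_le by (simp add: a'_def power_add)
      also have "\<dots> = (\<Sum>i<D. g i *s (l ^ (n + i) *s a (n + i)))"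
        unfolding rec' by (simp add: scale_sum_right power_add mult_ac)
      also have "\<dots> = (\<Sum>i=j..<D. g i *s (l ^ (n + i) *s a (n + i)))"
        using j_min by (intro sum.mono_neutral_right) auto
      also have "\<dots> = (\<Sum>i=0..<D - j. g (i + j) *s (l ^ (n + (i + j)) *s a (n + (i + j))))"
        using j_le sum.shift_bounds_nat_ivl[of "\<lambda>i. g i *s (l ^ (n + i) *s a (n + i))" 0 j "D - j"] by simp
      finally show ?thesis by (simp add: a'_def add_ac lessThan_atLeast0)
    qed
    obtain k where k: "k > 0" "\<And>r n. infinite {n. a' (r + k * n) = 0} \<Longrightarrow>
        \<exists>q\<in>zvars Y. q \<noteq> 0 \<and> q *s a' (r + k * n) = 0"
      using recurrence_torsion_classes[of "\<lambda>i. g (i + j)" Y a' "D - j"] g rec'' j by fastforce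
    have per_class: "eventually_periodic_set {n. a (j + r + k * n) = 0}" for r
    proof (cases "finite {n. a (j + r + k * n) = 0}")
      case True
      then show ?thesis by (rule eventually_periodic_set_finite)
    next
      case False
      define b where "b n = a (j + r + k * n)" for n
      have b: "a' (r + k * n) = l ^ (r + k * n + j) *s b n" for n by (simp add: a'_def b_def add_ac)
      have "infinite {n. a' (r + k * n) = 0}"
        using False unfolding b by (rule infinite_super[rotated]) (auto simp: b_def)
      then have tor: "\<exists>q\<in>zvars Y. q \<noteq> 0 \<and> q *s a' (r + k * n) = 0" for n using k(2) by blast
      \<comment> \<open>The power of \<open>l\<close> is absorbed into the annihilator, which stays
        in \<open>zvars Y\<close> and is nonzero.\<close>
      have tor_b: "\<exists>q\<in>zvars Y. q \<noteq> 0 \<and> q *s b n = 0" for n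
      proof -
        obtain q where "q \<in> zvars Y" "q \<noteq> 0" "q *s a' (r + k * n) = 0" using tor by blast
        then show ?thesis unfolding b
          using l by (intro bexI[of _ "q * l ^ (r + k * n + j)"]) auto
      qed
      have lin: "linrec (zvars V) b"
        unfolding b_def using linrec_subsequence[OF is_subring_zvars less.prems, of "j + r"] .
      obtain q where "q \<in> zvars Y" "q \<noteq> 0" "\<And>n. q *s b n = 0"
        using linrec_common_annihilator[OF lin tor_b] by blast
      then have "Y \<notin> independent_sets V b" unfolding independent_sets_def by blast
      moreover have "independent_sets V b \<subseteq> independent_sets V a"
        unfolding independent_sets_def b_def by blast
      ultimately have "independent_sets V b \<subset> independent_sets V a" using Y(1) by blast
      then have "card (independent_sets V b) < card (independent_sets V a)" by (rule psubset_card_mono[OF fin])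
      from less.hyps[OF this lin] show ?thesis unfolding b_def .
    qed
    have "{n. a n = 0} = {n. n < j \<and> a n = 0} \<union>
        (\<Union>r\<in>{..<k}. (\<lambda>n. j + r + k * n) ` {n. a (j + r + k * n) = 0})" (is "?L = ?R")
    proof
      show "?R \<subseteq> ?L" by auto
      show "?L \<subseteq> ?R"
      proof
        fix n assume "n \<in> ?L"
        then have n: "a n = 0" by simp
        show "n \<in> ?R"
        proof (cases "n < j")
          case False
          define r m where "r = (n - j) mod k" and "m = (n - j) div k"
          have "n = j + r + k * m" using False by (simp add: r_def m_def)
          moreover have "r < k" using k(1) by (simp add: r_def)
          ultimately show ?thesis using n by blast
        qed (use n in auto)
      qed
    qed
    then show ?thesis
      using per_class k(1)
      by (auto intro!: eventually_periodic_set_Un eventually_periodic_set_UN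
          eventually_periodic_set_affine intro: eventually_periodic_set_finite)
  qed
qed

end

theorem theorem1p2:
  fixes scale :: "'r::comm_ring_1 \<Rightarrow> 'm::ab_group_add \<Rightarrow> 'm"
    and phi :: "rat \<Rightarrow> 'r"
    and a :: "nat \<Rightarrow> 'm"
  assumes "rat_algebra_map phi"
    and "module scale"
    and "recurrence_seq scale a"
  shows "\<exists>F P. finite F \<and> finite P \<and> (\<forall>(m, n)\<in>P. n > 0) \<and>
           {n. a n = 0} = F \<union> (\<Union>(m, n)\<in>P. arith_prog m n)"
proof -
  interpret Modules.module scale by fact
  obtain d \<gamma> where rec: "\<And>n. a (n + d) = (\<Sum>i<d. scale (\<gamma> i) (a (n + i)))"
    using assms(3) unfolding recurrence_seq_def by blast
  obtain \<Phi> where \<Phi>: "\<Phi> 1 = 1" "\<And>f g. \<Phi> (f + g) = \<Phi> f + \<Phi> g" "\<And>f g. \<Phi> (f * g) = \<Phi> f * \<Phi> g"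
    "\<And>c. \<Phi> (of_int c) = of_int c" "\<And>i. \<Phi> (zX i) = \<gamma> i"
    using zpoly_substitution[of \<gamma>] by blast
  \<comment> \<open>The module is viewed over the polynomial ring, with \<open>zX i\<close> acting
    as the recurrence coefficient \<open>\<gamma> i\<close>.\<close>
  interpret z: zpoly_module "\<lambda>q. scale (\<Phi> q)"
    by unfold_locales (simp_all add: \<Phi> scale_left_distrib scale_right_distrib)
  have phi: "phi 1 = 1" "\<And>x y. phi (x + y) = phi x + phi y" "\<And>x y. phi (x * y) = phi x * phi y"
    using assms(1) unfolding rat_algebra_map_def by auto
  interpret phi: additive phi by unfold_locales (rule phi)
  have phi_int: "phi (of_int c) = of_int c" for c
  proof -
    have "phi (of_nat n) = of_nat n" for n
      by (induction n) (auto simp: phi phi.zero)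
    then show ?thesis by (cases c rule: int_cases2) (auto simp: phi.minus)
  qed
  \<comment> \<open>The image of \<open>1 / of_int c\<close> under \<open>phi\<close> inverts the
    integer \<open>c\<close> in the ring, so the module has no integer torsion.\<close>
  have tf: "m = 0" if "c \<noteq> 0" "scale (\<Phi> (of_int c)) m = 0" for c m
  proof -
    have "phi (1 / of_int c) * \<Phi> (of_int c) = phi (1 / of_int c * of_int c)"
      unfolding phi \<Phi> phi_int ..
    also have "\<dots> = 1" using that(1) phi(1) by simp
    finally have "m = scale (phi (1 / of_int c)) (scale (\<Phi> (of_int c)) m)" by simp
    then show ?thesis using that(2) by simp
  qed
  \<comment> \<open>Beyond index \<open>d\<close> the coefficients are set to 0, so that all of them
    lie in \<open>zvars {..<d}\<close>.\<close>
  have "z.linrec (zvars {..<d}) a"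
    unfolding z.linrec_def
    by (intro exI[of _ d] exI[of _ "\<lambda>i. if i < d then zX i else 0"]) (auto simp: \<Phi> rec)
  from z.linrec_zero_set[OF tf _ this] show ?thesis
    unfolding eventually_periodic_set_def by simp
qed

end
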